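(* Let $m\ge2$, $E:=\binom m2$, and let $Q\in\mathbb Z[x_1,\dots,x_n]$ be a positive-definite, convex homogeneous form of even degree $r\ge4$. If $Q$ is non-singular (i.e. $x\in\mathbb C^n$ and $\nabla Q(x)=0$ imply $x=0$), then the Birch rank of the map $\Phi(v)=(Q(v_i-v_j))_{1\le i<j\le m}$ satisfies $$\mathcal B(\Phi)\ge n-E+1.$$
   Context: The Birch rank is $$\mathcal B(\Phi):=nm-\dim_{\mathbb C}V_\Phi^*,\qquad V_\Phi^*:=\{v=(v_1,\dots,v_m)\in(\mathbb C^n)^m:\operatorname{rank}(\mathrm{Jac}\,\Phi(v))<E\},$$ where $\Phi$ is regarded as a polynomial map $(\mathbb C^n)^m\to\mathbb C^E$. *)

theory Defs
  imports "HOL-Analysis.Analysis" "HOL-Library.Poly_Mapping"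
begin

text \<open>
  A polynomial over \<open>'a\<close> in variables indexed by \<open>'v\<close> is a finitely supported map from exponent
  vectors to coefficients.
\<close>

type_synonym ('v, 'a) mpoly = "('v \<Rightarrow>\<^sub>0 nat) \<Rightarrow>\<^sub>0 'a"

definition mpoly_eval :: "('v::finite, 'a) mpoly \<Rightarrow> 'a::comm_ring_1 ^ 'v \<Rightarrow> 'a" where
  "mpoly_eval p x =
     (\<Sum>m\<in>Poly_Mapping.keys p. Poly_Mapping.lookup p m * (\<Prod>k\<in>UNIV. (x $ k) ^ Poly_Mapping.lookup m k))"

definition int_form :: "('v::finite, int) mpoly \<Rightarrow> 'a::comm_ring_1 ^ 'v \<Rightarrow> 'a" where
  "int_form Q = mpoly_eval (Poly_Mapping.map of_int Q)"

definition homogeneous :: "nat \<Rightarrow> ('v::finite, 'a::zero) mpoly \<Rightarrow> bool" where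
  "homogeneous r p \<longleftrightarrow>
     (\<forall>m\<in>Poly_Mapping.keys p. (\<Sum>k\<in>UNIV. Poly_Mapping.lookup m k) = r)"

definition positive_definite_form :: "('v::finite, int) mpoly \<Rightarrow> bool" where
  "positive_definite_form Q \<longleftrightarrow> (\<forall>x::real ^ 'v. x \<noteq> 0 \<longrightarrow> int_form Q x > 0)"

definition convex_form :: "('v::finite, int) mpoly \<Rightarrow> bool" where
  "convex_form Q \<longleftrightarrow> convex_on UNIV (int_form Q :: real ^ 'v \<Rightarrow> real)"

definition gradient :: "(complex ^ 'v::finite \<Rightarrow> complex) \<Rightarrow> complex ^ 'v \<Rightarrow> complex ^ 'v" where
  "gradient f x = (\<chi> k. deriv (\<lambda>t. f (x + axis k t)) 0)"

definition nonsingular_form :: "('v::finite, int) mpoly \<Rightarrow> bool" where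
  "nonsingular_form Q \<longleftrightarrow> (\<forall>x::complex ^ 'v. gradient (int_form Q) x = 0 \<longrightarrow> x = 0)"

definition Jac :: "(complex ^ 'v::finite \<Rightarrow> complex ^ 'e::finite) \<Rightarrow> complex ^ 'v \<Rightarrow> complex ^ 'v ^ 'e" where
  "Jac \<Phi> v = (\<chi> e. gradient (\<lambda>w. \<Phi> w $ e) v)"

definition zariski_closed :: "(complex ^ 'v::finite) set \<Rightarrow> bool" where
  "zariski_closed S \<longleftrightarrow> (\<exists>P. S = {x. \<forall>p\<in>P. mpoly_eval p x = 0})"

definition zariski_irreducible :: "(complex ^ 'v::finite) set \<Rightarrow> bool" where
  "zariski_irreducible S \<longleftrightarrow> S \<noteq> {} \<and>
     (\<forall>A B. zariski_closed A \<longrightarrow> zariski_closed B \<longrightarrow> S \<subseteq> A \<union> B \<longrightarrow> S \<subseteq> A \<or> S \<subseteq> B)"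

text \<open>
  The Krull dimension of a nonempty Zariski closed set \<open>X\<close>: the largest length \<open>d\<close> of a chain
  \<open>Z 0 \<subset> \<dots> \<subset> Z d\<close> of irreducible closed subsets of \<open>X\<close>. These lengths are bounded by
  \<open>CARD('v)\<close>, so that the supremum in \<open>nat\<close> is a maximum.
\<close>

definition zariski_dim :: "(complex ^ 'v::finite) set \<Rightarrow> nat" where
  "zariski_dim X = Sup {d. \<exists>Z. (\<forall>i\<le>d. zariski_closed (Z i) \<and> zariski_irreducible (Z i) \<and> Z i \<subseteq> X)
                                \<and> (\<forall>i<d. Z i \<subset> Z (Suc i))}"

definition birch_locus :: "(complex ^ 'v::finite \<Rightarrow> complex ^ 'e::finite) \<Rightarrow> (complex ^ 'v) set" where
  "birch_locus \<Phi> = {v. rank (Jac \<Phi> v) < CARD('e)}"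

definition birch_rank :: "(complex ^ 'v::finite \<Rightarrow> complex ^ 'e::finite) \<Rightarrow> int" where
  "birch_rank \<Phi> = int CARD('v) - int (zariski_dim (birch_locus \<Phi>))"

text \<open>
  The type \<open>'m lt_pair\<close> is the index set of all \<open>(i, j)\<close> with \<open>i < j\<close>. The class \<open>card2\<close> says that
  \<open>'m\<close> is finite with at least two elements, so that there is such a pair.
\<close>

typedef (overloaded) ('m::"{card2,linorder}") lt_pair = "{(i::'m, j). i < j}"
proof -
  have "\<exists>i j :: 'm. i \<noteq> j"
  proof (rule ccontr)
    assume "\<nexists>i j :: 'm. i \<noteq> j"
    then have "(UNIV :: 'm set) \<subseteq> {undefined}" by auto
    then have "CARD('m) \<le> card {undefined :: 'm}" by (intro card_mono) auto
    then show False using two_le_card[where 'a = 'm] by simp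
  qed
  then obtain i j :: 'm where "i \<noteq> j" by blast
  then have "i < j \<or> j < i" by (metis linorder_neq_iff)
  then show ?thesis by blast
qed

instance lt_pair :: ("{card2,linorder}") finite
proof
  have "(UNIV :: 'a lt_pair set) = Abs_lt_pair ` {(i, j). i < j}"
    by (simp add: type_definition.Abs_image[OF type_definition_lt_pair])
  then show "finite (UNIV :: 'a lt_pair set)" by (metis finite finite_imageI)
qed

lemma card_lt_pair: "CARD('m::{card2,linorder} lt_pair) = CARD('m) choose 2"
proof -
  have "CARD('m lt_pair) = card {(i::'m, j). i < j}"
    by (rule type_definition.card[OF type_definition_lt_pair])
  also have "\<dots> = card {K :: 'm set. K \<subseteq> UNIV \<and> card K = 2}"
  proof (rule bij_betw_same_card[of "\<lambda>(i, j). {i, j}"])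
    show "bij_betw (\<lambda>(i, j). {i, j}) {(i::'m, j). i < j} {K. K \<subseteq> UNIV \<and> card K = 2}"
      unfolding bij_betw_def
    proof
      show "inj_on (\<lambda>(i, j). {i, j}) {(i::'m, j). i < j}"
        by (auto simp: inj_on_def doubleton_eq_iff dest: order.asym)
      show "(\<lambda>(i, j). {i, j}) ` {(i::'m, j). i < j} = {K. K \<subseteq> UNIV \<and> card K = 2}"
      proof
        show "{K. K \<subseteq> UNIV \<and> card K = 2} \<subseteq> (\<lambda>(i, j). {i, j}) ` {(i::'m, j). i < j}"
        proof
          fix K :: "'m set" assume "K \<in> {K. K \<subseteq> UNIV \<and> card K = 2}"
          then obtain i j where K: "K = {i, j}" "i \<noteq> j" by (auto simp: card_2_iff)
          then have "i < j \<or> j < i" by (metis linorder_neq_iff)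
          then have "(i, j) \<in> {(i, j). i < j} \<or> (j, i) \<in> {(i, j). i < j}" by simp
          moreover have "K = (\<lambda>(i, j). {i, j}) (i, j)" "K = (\<lambda>(i, j). {i, j}) (j, i)"
            using K(1) by (simp_all add: insert_commute)
          ultimately show "K \<in> (\<lambda>(i, j). {i, j}) ` {(i::'m, j). i < j}" by (metis imageI)
        qed
      qed (auto simp: card_2_iff)
    qed
  qed
  also have "\<dots> = CARD('m) choose 2" by (rule n_subsets) simp
  finally show ?thesis .
qed

text \<open>\<open>(\<complex>\<^sup>n)\<^sup>m\<close> is the affine space with coordinates indexed by \<open>'m \<times> 'n\<close>.\<close>

definition component :: "complex ^ ('m::finite \<times> 'n::finite) \<Rightarrow> 'm \<Rightarrow> complex ^ 'n" where
  "component v i = (\<chi> k. v $ (i, k))"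

definition difference_map ::
  "('n::finite, int) mpoly \<Rightarrow> complex ^ ('m::{card2,linorder} \<times> 'n) \<Rightarrow> complex ^ 'm lt_pair" where
  "difference_map Q v =
     (\<chi> e. case Rep_lt_pair e of (i, j) \<Rightarrow> int_form Q (component v i - component v j))"

end

theory Submission
  imports Defs "HOL-Library.Function_Algebras" "HOL-Computational_Algebra.Fundamental_Theorem_Algebra"
begin

text \<open>
  Let \<open>v\<close> be a point where the Jacobian is rank deficient, so that its rows satisfy a linear relation
  with coefficients \<open>c\<^sub>e\<close>, and normalise one of them, \<open>c\<^sub>e = 1\<close> for \<open>e = (p, q)\<close>. The columns
  belonging to \<open>v\<^sub>q\<close> express \<open>\<nabla>Q(v\<^sub>p - v\<^sub>q)\<close> as a polynomial in the other coefficients \<open>c\<close> and the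
  vectors \<open>v\<^sub>k\<close> with \<open>k \<noteq> p\<close>. As \<open>\<nabla>Q\<close> has no common zero but \<open>0\<close>, the graded Nullstellensatz makes
  the coordinates of \<open>v\<^sub>p - v\<^sub>q\<close> integral over these \<open>D = (m - 1) n + E - 1\<close> functions. Hence on the
  locus the power products with exponents at most \<open>k\<close> of any given polynomials span a space
  of dimension \<open>O(k\<^sup>D)\<close>. A chain of \<open>d + 1\<close> irreducible closed subsets, on the other hand, gives \<open>d\<close>
  polynomials, the \<open>i\<close>-th vanishing on the \<open>i\<close>-th set but not on the next, which are algebraically
  independent and so have \<open>(k + 1)\<^sup>d\<close> independent power products. Thus \<open>d \<le> D\<close>.
\<close>

section \<open>Polynomial functions\<close>

lemma fun_power_apply: "(f ^ n) x = f x ^ n" for f :: "'a \<Rightarrow> 'b::comm_ring_1"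
  by (induction n) simp_all

lemma fun_sum_apply: "sum f A x = (\<Sum>a\<in>A. f a x)" for f :: "'c \<Rightarrow> 'a \<Rightarrow> 'b::comm_ring_1"
  by (induction A rule: infinite_finite_induct) simp_all

lemma fun_prod_apply: "prod f A x = (\<Prod>a\<in>A. f a x)" for f :: "'c \<Rightarrow> 'a \<Rightarrow> 'b::comm_ring_1"
  by (induction A rule: infinite_finite_induct) simp_all

definition scale_fun :: "complex \<Rightarrow> ('a \<Rightarrow> complex) \<Rightarrow> 'a \<Rightarrow> complex" where
  "scale_fun c f = (\<lambda>x. c * f x)"

lemma scale_fun_apply: "scale_fun c f x = c * f x"
  by (simp add: scale_fun_def)

text \<open>
  As simp rules, the pointwise laws would also unfold the eta-expanded operations that induction
  rules produce.
\<close>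

declare plus_fun_apply [simp del] zero_fun_apply [simp del] times_fun_apply [simp del] one_fun_apply [simp del]

lemmas fun_apply = plus_fun_apply zero_fun_apply times_fun_apply one_fun_apply scale_fun_apply
  fun_power_apply fun_sum_apply fun_prod_apply

interpretation funs: vector_space scale_fun
  by standard (auto simp: fun_eq_iff fun_apply algebra_simps)

text \<open>The dimension count behind both main arguments. It is stated for an indexed family
  because members with different indices may coincide as functions, which already is a
  relation.\<close>

lemma dependent_family:
  assumes "finite F" and "finite A" and "card F < card A"
    and q: "\<And>a. a \<in> A \<Longrightarrow> q a \<in> funs.span F"
  shows "\<exists>c a0. a0 \<in> A \<and> c a0 \<noteq> 0 \<and> (\<forall>x. (\<Sum>a\<in>A. c a * q a x) = 0)"
proof (rule ccontr)
  assume "\<not> ?thesis"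
  then have indep: "c a = 0" if "\<forall>x. (\<Sum>a\<in>A. c a * q a x) = 0" "a \<in> A" for c a
    using that by blast
  have inj: "inj_on q A"
  proof (rule inj_onI, rule ccontr)
    fix a b assume ab: "a \<in> A" "b \<in> A" "q a = q b" "a \<noteq> b"
    \<comment> \<open>If \<open>q a\<close> and \<open>q b\<close> coincide, the coefficients 1 at
      \<open>a\<close> and -1 at \<open>b\<close> give a nontrivial relation.\<close>
    define c where "c = (\<lambda>x. (if x = a then 1 else 0) - (if x = b then 1 else (0::complex)))"
    have "(\<Sum>x\<in>A. c x * q x y) = 0" for y
      using ab \<open>finite A\<close> by (simp add: c_def left_diff_distrib sum_subtractf if_distrib[of "\<lambda>z. z * _"] sum.delta cong: if_cong)
    then have "c a = 0" using indep ab by blast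
    then show False using ab by (simp add: c_def)
  qed
  have "funs.independent (q ` A)"
  proof (rule funs.independent_if_scalars_zero)
    fix f v assume *: "(\<Sum>v\<in>q ` A. scale_fun (f v) v) = 0" and v: "v \<in> q ` A"
    have "(\<Sum>a\<in>A. f (q a) * q a x) = 0" for x
      using fun_cong[OF *, of x] by (simp add: sum.reindex[OF inj] fun_apply)
    then show "f v = 0" using indep[of "\<lambda>a. f (q a)"] v by auto
  qed (use \<open>finite A\<close> in simp)
  then have "card (q ` A) \<le> card F"
    using funs.independent_span_bound[OF \<open>finite F\<close>] q by blast
  then show False using card_image[OF inj] assms(3) by simp
qed

definition power_product :: "('i \<Rightarrow> 'a \<Rightarrow> complex) \<Rightarrow> 'i set \<Rightarrow> ('i \<Rightarrow> nat) \<Rightarrow> 'a \<Rightarrow> complex" where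
  "power_product u I m = (\<lambda>x. \<Prod>i\<in>I. u i x ^ m i)"

abbreviation monomial :: "('v::finite \<Rightarrow> nat) \<Rightarrow> complex ^ 'v \<Rightarrow> complex" where
  "monomial \<equiv> power_product (\<lambda>i x. x $ i) UNIV"

lemma power_product_add: "power_product u I (\<lambda>i. m i + n i) = power_product u I m * power_product u I n"
  by (simp add: power_product_def fun_eq_iff fun_apply power_add prod.distrib)

text \<open>Polynomials are treated as functions, which loses nothing over the infinite field
  \<complex> and makes restriction to a set and the vector space structure immediate.
  \<open>mpoly_eval_in_polyfuns\<close> and \<open>polyfuns_mpoly_eval\<close> tie them to formal
  polynomials.\<close>

definition polyfuns :: "(complex ^ 'v::finite \<Rightarrow> complex) set" where
  "polyfuns = funs.span (range monomial)"

lemma polyfuns_zero: "0 \<in> polyfuns"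
  by (simp add: polyfuns_def funs.span_zero)

lemma polyfuns_add: "p \<in> polyfuns \<Longrightarrow> q \<in> polyfuns \<Longrightarrow> p + q \<in> polyfuns"
  by (simp add: polyfuns_def funs.span_add)

lemma polyfuns_scale: "p \<in> polyfuns \<Longrightarrow> scale_fun c p \<in> polyfuns"
  by (simp add: polyfuns_def funs.span_scale)

lemma polyfuns_sum: "(\<And>a. a \<in> A \<Longrightarrow> p a \<in> polyfuns) \<Longrightarrow> (\<Sum>a\<in>A. p a) \<in> polyfuns"
  by (simp add: polyfuns_def funs.span_sum)

lemma polyfuns_monomial: "monomial m \<in> polyfuns"
  by (simp add: polyfuns_def funs.span_base)

lemma monomial_zero: "monomial (\<lambda>_. 0) = 1"
  by (simp add: power_product_def fun_eq_iff fun_apply)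

lemma polyfuns_const: "(\<lambda>_. c) \<in> polyfuns"
proof -
  have "(\<lambda>_. c) = scale_fun c (monomial (\<lambda>_. 0))"
    by (simp add: monomial_zero fun_eq_iff fun_apply)
  then show ?thesis by (metis polyfuns_scale polyfuns_monomial)
qed

lemma polyfuns_one: "1 \<in> polyfuns"
  using polyfuns_const[of 1] by (simp add: one_fun_def)

lemma monomial_unit: "monomial (\<lambda>j. if j = i then k else 0) = (\<lambda>x. (x $ i) ^ k)"
  by (auto simp: power_product_def if_distrib prod.delta cong: if_cong)

lemma polyfuns_coord: "(\<lambda>x. x $ i) \<in> polyfuns"
  using polyfuns_monomial[of "\<lambda>j. if j = i then 1 else 0"] by (simp only: monomial_unit power_one_right)

lemma polyfuns_mult:
  assumes "p \<in> polyfuns" "q \<in> polyfuns"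
  shows "p * q \<in> polyfuns"
proof -
  have mono: "monomial m * q \<in> polyfuns" for m
    using assms(2) unfolding polyfuns_def
  proof (induction rule: funs.span_induct_alt)
    case base
    then show ?case by (simp add: funs.span_zero)
  next
    case (step c x y)
    then obtain n where n: "x = monomial n" by blast
    have "monomial m * (scale_fun c x + y) = scale_fun c (monomial (\<lambda>i. m i + n i)) + monomial m * y"
      by (simp add: n power_product_add fun_eq_iff fun_apply algebra_simps)
    then show ?case
      using step by (simp add: funs.span_add funs.span_scale funs.span_base)
  qed
  show ?thesis
    using assms(1)[unfolded polyfuns_def]
  proof (induction rule: funs.span_induct_alt)
    case base
    then show ?case by (simp add: polyfuns_zero)
  next
    case (step c x y)
    have "(scale_fun c x + y) * q = scale_fun c (x * q) + y * q"
      by (simp add: fun_eq_iff fun_apply algebra_simps)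
    then show ?case
      using step mono by (auto simp: polyfuns_add polyfuns_scale)
  qed
qed

lemma polyfuns_diff: "p \<in> polyfuns \<Longrightarrow> q \<in> polyfuns \<Longrightarrow> p - q \<in> polyfuns"
  by (simp add: polyfuns_def funs.span_diff)

lemma polyfuns_power: "p \<in> polyfuns \<Longrightarrow> p ^ k \<in> polyfuns"
  by (induction k) (simp_all add: polyfuns_one polyfuns_mult)

lemma polyfuns_prod: "(\<And>a. a \<in> A \<Longrightarrow> p a \<in> polyfuns) \<Longrightarrow> (\<Prod>a\<in>A. p a) \<in> polyfuns"
  by (induction A rule: infinite_finite_induct) (simp_all add: polyfuns_one polyfuns_mult)

lemma polyfuns_induct [consumes 1, case_names const coord add mult]:
  assumes p: "p \<in> polyfuns"
    and const: "\<And>c. P (\<lambda>_. c)" and coord: "\<And>i. P (\<lambda>x. x $ i)"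
    and add: "\<And>p q. P p \<Longrightarrow> P q \<Longrightarrow> P (p + q)" and mult: "\<And>p q. P p \<Longrightarrow> P q \<Longrightarrow> P (p * q)"
  shows "P p"
proof -
  have pow: "P ((\<lambda>x. x $ i) ^ k)" for i k
  proof (induction k)
    case 0
    then show ?case using const[of 1] by (simp add: one_fun_def)
  qed (simp only: power_Suc coord mult)
  have "P (\<Prod>i\<in>I. (\<lambda>x. x $ i) ^ m i)" for I m
  proof (induction I rule: infinite_finite_induct)
    case (insert i I)
    then show ?case by (simp add: pow mult)
  qed (use const[of 1] in \<open>simp_all add: one_fun_def\<close>)
  moreover have "monomial m = (\<Prod>i\<in>UNIV. (\<lambda>x. x $ i) ^ m i)" for m :: "'a \<Rightarrow> nat"
    by (simp add: power_product_def fun_eq_iff fun_apply)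
  ultimately have mono: "P (monomial m)" for m by simp
  show ?thesis
    using p[unfolded polyfuns_def]
  proof (induction rule: funs.span_induct_alt)
    case base
    then show ?case using const[of 0] by (simp add: zero_fun_def)
  next
    case (step c x y)
    have "P ((\<lambda>_. c) * x)" using step mono const mult by blast
    then show ?case using step add[of "(\<lambda>_. c) * x" y] by (simp add: times_fun_def scale_fun_def)
  qed
qed

definition box_polyfuns :: "nat \<Rightarrow> (complex ^ 'v::finite \<Rightarrow> complex) set" where
  "box_polyfuns k = monomial ` {m. \<forall>i. m i \<le> k}"

lemma finite_box_polyfuns: "finite (box_polyfuns k :: (complex ^ 'v::finite \<Rightarrow> complex) set)"
proof -
  have "{m::'v \<Rightarrow> nat. \<forall>i. m i \<le> k} = PiE UNIV (\<lambda>_. {..k})" by (auto simp: PiE_iff)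
  then show ?thesis by (simp add: box_polyfuns_def finite_PiE)
qed

text \<open>The polynomial ring is a countable union of finite-dimensional spaces. This form of
  countable dimension is what the pigeonhole argument in \<open>coord_residue\<close>
  consumes.\<close>

lemma polyfuns_box:
  assumes "p \<in> polyfuns"
  shows "\<exists>k. p \<in> funs.span (box_polyfuns k)"
  using assms[unfolded polyfuns_def]
proof (induction rule: funs.span_induct_alt)
  case base
  then show ?case by (auto intro: funs.span_zero)
next
  case (step c x y)
  then obtain m k where m: "x = monomial m" and k: "y \<in> funs.span (box_polyfuns k)" by blast
  have "x \<in> box_polyfuns (max k (Max (range m)))"
    by (auto simp: m box_polyfuns_def le_max_iff_disj)
  moreover have "box_polyfuns k \<subseteq> box_polyfuns (max k (Max (range m)))"
    unfolding box_polyfuns_def by (rule image_mono) (auto simp: le_max_iff_disj)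
  ultimately show ?case
    by (meson k funs.span_add funs.span_scale funs.span_base funs.span_mono subsetD)
qed

section \<open>The Nullstellensatz\<close>

definition polyfun_ideal :: "(complex ^ 'v::finite \<Rightarrow> complex) set \<Rightarrow> bool" where
  "polyfun_ideal J \<longleftrightarrow> J \<subseteq> polyfuns \<and> 0 \<in> J \<and> (\<forall>p\<in>J. \<forall>q\<in>J. p + q \<in> J) \<and> (\<forall>p\<in>polyfuns. \<forall>q\<in>J. p * q \<in> J)"

lemma polyfun_ideal_diff:
  assumes "polyfun_ideal J" "p \<in> J" "q \<in> J"
  shows "p - q \<in> J"
proof -
  have "(\<lambda>_. -1) * q \<in> J" using assms polyfuns_const unfolding polyfun_ideal_def by blast
  then have "p + (\<lambda>_. -1) * q \<in> J" using assms unfolding polyfun_ideal_def by blast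
  moreover have "p + (\<lambda>_. -1) * q = p - q" by (simp add: fun_eq_iff fun_apply)
  ultimately show ?thesis by simp
qed

lemma polyfun_ideal_sum:
  assumes "polyfun_ideal J" "\<And>a. a \<in> A \<Longrightarrow> p a \<in> J"
  shows "(\<Sum>a\<in>A. p a) \<in> J"
  using assms by (induction A rule: infinite_finite_induct) (auto simp: polyfun_ideal_def)

lemma polyfun_ideal_plus_multiples:
  fixes p :: "complex ^ 'v::finite \<Rightarrow> complex"
  assumes "polyfun_ideal J" "p \<in> polyfuns"
  shows "polyfun_ideal {j + q * p | j q. j \<in> J \<and> q \<in> polyfuns}"
  unfolding polyfun_ideal_def
proof (intro conjI ballI)
  show "{j + q * p | j q. j \<in> J \<and> q \<in> polyfuns} \<subseteq> polyfuns"
    using assms by (auto simp: polyfun_ideal_def intro!: polyfuns_add polyfuns_mult)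
  have "0 = 0 + 0 * p" by simp
  then show "0 \<in> {j + q * p | j q. j \<in> J \<and> q \<in> polyfuns}"
    using assms polyfuns_zero unfolding polyfun_ideal_def by blast
next
  fix a b assume a: "a \<in> {j + q * p | j q. j \<in> J \<and> q \<in> polyfuns}"
    and b: "b \<in> {j + q * p | j q. j \<in> J \<and> q \<in> polyfuns}"
  obtain j q where a': "a = j + q * p" "j \<in> J" "q \<in> polyfuns" using a by blast
  obtain j' q' where b': "b = j' + q' * p" "j' \<in> J" "q' \<in> polyfuns" using b by blast
  have "a + b = (j + j') + (q + q') * p" using a' b' by (simp add: algebra_simps)
  moreover have "j + j' \<in> J" "q + q' \<in> polyfuns"
    using a' b' assms by (auto simp: polyfun_ideal_def polyfuns_add)
  ultimately show "a + b \<in> {j + q * p | j q. j \<in> J \<and> q \<in> polyfuns}" by blast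
next
  fix a b :: "complex ^ 'v \<Rightarrow> complex" assume a: "a \<in> polyfuns" and b: "b \<in> {j + q * p | j q. j \<in> J \<and> q \<in> polyfuns}"
  obtain j q where b': "b = j + q * p" "j \<in> J" "q \<in> polyfuns" using b by blast
  have "a * b = a * j + (a * q) * p" using b' by (simp add: algebra_simps)
  moreover have "a * j \<in> J" "a * q \<in> polyfuns"
    using a b' assms by (auto simp: polyfun_ideal_def polyfuns_mult)
  ultimately show "a * b \<in> {j + q * p | j q. j \<in> J \<and> q \<in> polyfuns}" by blast
qed

text \<open>Such a \<open>J\<close> corresponds to a maximal ideal of the localisation at
  \<open>h\<close>. Working with it yields the Nullstellensatz for \<open>h\<close> directly,
  without the extra variable of the Rabinowitsch trick.\<close>

locale power_avoiding_ideal =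
  fixes J :: "(complex ^ 'v::finite \<Rightarrow> complex) set" and h
  assumes ideal: "polyfun_ideal J" and h: "h \<in> polyfuns" and avoid: "\<And>k. h ^ k \<notin> J"
    and maximal: "\<And>J'. polyfun_ideal J' \<Longrightarrow> (\<And>k. h ^ k \<notin> J') \<Longrightarrow> J \<subseteq> J' \<Longrightarrow> J' = J"
begin

lemma mult_mem: "p \<in> polyfuns \<Longrightarrow> q \<in> J \<Longrightarrow> p * q \<in> J"
  using ideal by (auto simp: polyfun_ideal_def)

lemma add_mem: "p \<in> J \<Longrightarrow> q \<in> J \<Longrightarrow> p + q \<in> J"
  using ideal by (auto simp: polyfun_ideal_def)

text \<open>By maximality, the ideal generated by \<open>J\<close> and \<open>p\<close> contains a
  power of \<open>h\<close>. So modulo \<open>J\<close> every \<open>p\<close> outside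
  \<open>J\<close> is invertible up to a power of \<open>h\<close>, with \<open>q\<close> in the
  role of \<open>h ^ k / p\<close>.\<close>

lemma power_in_extension:
  assumes "p \<in> polyfuns" "p \<notin> J"
  shows "\<exists>k q. q \<in> polyfuns \<and> h ^ k - q * p \<in> J"
proof -
  let ?J = "{j + q * p | j q. j \<in> J \<and> q \<in> polyfuns}"
  have sub: "J \<subseteq> ?J"
  proof
    fix j assume "j \<in> J"
    moreover have "j = j + 0 * p" by simp
    ultimately show "j \<in> ?J" using polyfuns_zero by blast
  qed
  have "p = 0 + 1 * p" by simp
  then have "p \<in> ?J"
    using ideal polyfuns_one unfolding polyfun_ideal_def by blast
  then have "?J \<noteq> J" using assms by blast
  then obtain k where "h ^ k \<in> ?J"
    using maximal[OF polyfun_ideal_plus_multiples[OF ideal assms(1)] _ sub] by blast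
  then obtain j q where j: "h ^ k = j + q * p" "j \<in> J" "q \<in> polyfuns" by blast
  then have "h ^ k - q * p = j" by simp
  then show ?thesis using j by blast
qed

lemma prime:
  assumes "p \<in> polyfuns" "p \<notin> J" "q \<in> polyfuns" "q \<notin> J"
  shows "p * q \<notin> J"
proof
  assume pq: "p * q \<in> J"
  obtain k a where a: "a \<in> polyfuns" "h ^ k - a * p \<in> J" using power_in_extension assms by blast
  obtain l b where b: "b \<in> polyfuns" "h ^ l - b * q \<in> J" using power_in_extension assms by blast
  \<comment> \<open>Multiplying the congruences \<open>h ^ k = a * p\<close> and
    \<open>h ^ l = b * q\<close> modulo \<open>J\<close> shows that \<open>h ^ (k + l)\<close> is
    congruent to a multiple of \<open>p * q\<close>.\<close>
  have "h ^ (k + l) = h ^ l * (h ^ k - a * p) + (a * p) * (h ^ l - b * q) + (a * b) * (p * q)"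
    by (simp add: algebra_simps power_add)
  also have "\<dots> \<in> J"
    using a b pq assms h
    by (intro add_mem mult_mem[OF polyfuns_power] mult_mem[OF polyfuns_mult[of a]] mult_mem[OF polyfuns_mult[of a b] pq])
  finally show False using avoid by blast
qed

lemma const_notin: "c \<noteq> 0 \<Longrightarrow> (\<lambda>_. c) \<notin> J"
proof
  assume "c \<noteq> 0" "(\<lambda>_. c) \<in> J"
  then have "(\<lambda>_. 1 / c) * (\<lambda>_. c) \<in> J" using mult_mem polyfuns_const by blast
  then show False using \<open>c \<noteq> 0\<close> avoid[of 0] by (simp add: times_fun_def one_fun_def)
qed

text \<open>
  The field of fractions of the residue ring has countable dimension over \<open>\<complex>\<close>, while the functions
  \<open>1 / (x\<^sub>b - a)\<close> would be uncountably many independent elements of it.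
\<close>

lemma coord_residue: "\<exists>a. (\<lambda>x. x $ b - a) \<in> J"
proof (rule ccontr)
  assume none: "\<not> ?thesis"
  have lin: "(\<lambda>x. x $ b - a) \<in> polyfuns" for a
    using polyfuns_diff[OF polyfuns_coord[of b] polyfuns_const[of a]] by (simp add: fun_diff_def)
  have "\<exists>k q e. q \<in> funs.span (box_polyfuns e) \<and> h ^ k - q * (\<lambda>x. x $ b - a) \<in> J" for a
    using power_in_extension[OF lin, of a] none polyfuns_box by blast
  then obtain K Q E where QE: "\<And>a. Q a \<in> funs.span (box_polyfuns (E a))"
    and KQ: "\<And>a. h ^ K a - Q a * (\<lambda>x. x $ b - a) \<in> J"
    by metis
  \<comment> \<open>Pigeonhole: uncountably many \<open>a\<close> are distributed over countably
    many pairs of an exponent \<open>k\<close> and a box size \<open>e\<close>.\<close>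
  have "\<exists>k e. infinite {a. K a = k \<and> E a = e}"
  proof (rule ccontr)
    assume "\<not> ?thesis"
    then have "countable (\<Union>k. \<Union>e. {a. K a = k \<and> E a = e})"
      by (intro countable_UN) (auto intro: countable_finite)
    moreover have "(\<Union>k. \<Union>e. {a. K a = k \<and> E a = e}) = UNIV" by auto
    ultimately show False using uncountable_UNIV_complex by simp
  qed
  then obtain k e where inf: "infinite {a. K a = k \<and> E a = e}" by blast
  \<comment> \<open>One element more than the box has monomials, so that the functions
    \<open>Q a\<close>, which stand for \<open>h ^ k / (x $ b - a)\<close>, must be linearly
    dependent.\<close>
  obtain A where A: "A \<subseteq> {a. K a = k \<and> E a = e}" "finite A"
    "card A = Suc (card (box_polyfuns e :: (complex ^ 'v \<Rightarrow> complex) set))"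
    using infinite_arbitrarily_large[OF inf] by blast
  have "\<exists>c a0. a0 \<in> A \<and> c a0 \<noteq> 0 \<and> (\<forall>x. (\<Sum>a\<in>A. c a * Q a x) = 0)"
    using A QE by (intro dependent_family[OF finite_box_polyfuns]) auto
  then obtain c a0 where c: "a0 \<in> A" "c a0 \<noteq> 0" "\<And>x. (\<Sum>a\<in>A. c a * Q a x) = 0" by blast
  \<comment> \<open>Clearing denominators in the sum of the \<open>c a / (x $ b - a)\<close> leaves
    the numerator \<open>u\<close>. It is not zero, since at \<open>a0\<close> every summand but
    that of \<open>a0\<close> vanishes.\<close>
  define w where "w a = (\<Prod>t\<in>A - {a}. [:-t, 1:])" for a :: complex
  define u where "u = (\<Sum>a\<in>A. smult (c a) (w a))"
  have "poly (w a) a0 = 0" if "a \<in> A - {a0}" for a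
    using that c(1) A(2) by (auto simp: w_def poly_prod intro!: prod_zero)
  then have "poly u a0 = c a0 * poly (w a0) a0"
    using c(1) A(2) by (simp add: u_def poly_sum sum.remove[of A a0])
  moreover have "poly (w a0) a0 \<noteq> 0"
    using A(2) by (auto simp: w_def poly_prod)
  ultimately have "u \<noteq> 0" using c(2) by auto
  have pol: "(\<lambda>x. poly v (x $ b)) \<in> polyfuns" for v
  proof (induction v)
    case 0
    then show ?case using polyfuns_const[of 0] by simp
  next
    case (pCons a v)
    have "(\<lambda>x. poly (pCons a v) (x $ b)) = (\<lambda>_. a) + (\<lambda>x. x $ b) * (\<lambda>x. poly v (x $ b))"
      by (simp add: fun_eq_iff fun_apply)
    then show ?case using pCons by (metis polyfuns_add polyfuns_mult polyfuns_const polyfuns_coord)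
  qed
  \<comment> \<open>A nonzero polynomial in the one coordinate \<open>x $ b\<close> splits over
    \<complex> into linear factors. None of them lies in \<open>J\<close> by assumption, hence
    neither does the product, as \<open>J\<close> is prime.\<close>
  have notin: "(\<lambda>x. poly v (x $ b)) \<notin> J" if "v \<noteq> 0" for v
    using that
  proof (induction "degree v" arbitrary: v)
    case 0
    then obtain a where "v = [:a:]" by (metis degree_eq_zeroE)
    then show ?case using 0 const_notin by simp
  next
    case (Suc n)
    then have "\<not> constant (poly v)" by (simp add: constant_degree)
    then obtain z where "poly v z = 0" using fundamental_theorem_of_algebra by blast
    then obtain v' where v': "v = [:-z, 1:] * v'" by (metis dvdE poly_eq_0_iff_dvd)
    have "v' \<noteq> 0" using v' Suc by auto
    then have "degree v = Suc (degree v')" unfolding v' by (subst degree_mult_eq) auto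
    then have IH: "(\<lambda>x. poly v' (x $ b)) \<notin> J" using Suc \<open>v' \<noteq> 0\<close> by simp
    have "(\<lambda>x. x $ b - z) * (\<lambda>x. poly v' (x $ b)) \<notin> J"
      using prime[OF lin _ pol IH] none by blast
    moreover have "(\<lambda>x. poly v (x $ b)) = (\<lambda>x. x $ b - z) * (\<lambda>x. poly v' (x $ b))"
      by (simp add: v' fun_eq_iff fun_apply algebra_simps)
    ultimately show ?case by simp
  qed
  \<comment> \<open>The weights are chosen such that the terms with \<open>Q a\<close> combine to a
    multiple of the relation and cancel. What remains is \<open>h ^ k\<close> times
    \<open>u\<close>, a product of two functions outside the prime ideal \<open>J\<close>.\<close>
  have "(\<Sum>a\<in>A. (\<lambda>x. c a * poly (w a) (x $ b)) * (h ^ K a - Q a * (\<lambda>x. x $ b - a))) \<in> J"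
  proof (rule polyfun_ideal_sum[OF ideal])
    fix a
    have "(\<lambda>x. c a * poly (w a) (x $ b)) \<in> polyfuns"
      using polyfuns_scale[OF pol, of "c a" "w a"] by (simp add: scale_fun_def)
    then show "(\<lambda>x. c a * poly (w a) (x $ b)) * (h ^ K a - Q a * (\<lambda>x. x $ b - a)) \<in> J"
      using KQ by (rule mult_mem)
  qed
  also have "(\<Sum>a\<in>A. (\<lambda>x. c a * poly (w a) (x $ b)) * (h ^ K a - Q a * (\<lambda>x. x $ b - a)))
           = h ^ k * (\<lambda>x. poly u (x $ b))"
  proof
    fix x
    have "(\<Sum>a\<in>A. c a * poly (w a) (x $ b) * (h x ^ K a - Q a x * (x $ b - a)))
        = (\<Sum>a\<in>A. h x ^ k * (c a * poly (w a) (x $ b)) - (\<Prod>t\<in>A. x $ b - t) * (c a * Q a x))"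
    proof (rule sum.cong[OF refl])
      fix a assume a: "a \<in> A"
      have "(\<Prod>t\<in>A. x $ b - t) = (x $ b - a) * poly (w a) (x $ b)"
        using a A(2) by (simp add: w_def poly_prod prod.remove)
      moreover have "K a = k" using A(1) a by blast
      ultimately show "c a * poly (w a) (x $ b) * (h x ^ K a - Q a x * (x $ b - a))
          = h x ^ k * (c a * poly (w a) (x $ b)) - (\<Prod>t\<in>A. x $ b - t) * (c a * Q a x)"
        by (simp only:) (simp add: algebra_simps)
    qed
    also have "\<dots> = h x ^ k * poly u (x $ b)"
      by (simp add: sum_subtractf u_def poly_sum c(3) flip: sum_distrib_left)
    finally show "(\<Sum>a\<in>A. (\<lambda>x. c a * poly (w a) (x $ b)) * (h ^ K a - Q a * (\<lambda>x. x $ b - a))) x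
           = (h ^ k * (\<lambda>x. poly u (x $ b))) x"
      by (simp add: fun_apply)
  qed
  finally have "h ^ k * (\<lambda>x. poly u (x $ b)) \<in> J" .
  moreover have "h ^ k * (\<lambda>x. poly u (x $ b)) \<notin> J"
    using prime[OF polyfuns_power[OF h] avoid pol notin[OF \<open>u \<noteq> 0\<close>]] .
  ultimately show False by blast
qed

text \<open>The residues of the coordinates assemble to a point \<open>z\<close>, and congruence to
  the value at \<open>z\<close> passes from the coordinates to sums and products.\<close>

lemma residue_point: "\<exists>z. \<forall>p\<in>polyfuns. (\<lambda>x. p x - p z) \<in> J"
proof -
  obtain c where c: "\<And>b. (\<lambda>x. x $ b - c b) \<in> J" using coord_residue by metis
  define z where "z = (\<chi> b. c b)"
  have "(\<lambda>x. p x - p z) \<in> J" if "p \<in> polyfuns" for p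
  proof -
    have "p \<in> polyfuns \<and> (\<lambda>x. p x - p z) \<in> J"
      using that
    proof (induction rule: polyfuns_induct)
      case (const a)
      then show ?case using ideal polyfuns_const by (simp add: polyfun_ideal_def zero_fun_def)
    next
      case (coord i)
      then show ?case using c[of i] polyfuns_coord by (simp add: z_def)
    next
      case (add p q)
      have "(\<lambda>x. (p + q) x - (p + q) z) = (\<lambda>x. p x - p z) + (\<lambda>x. q x - q z)"
        by (simp add: fun_eq_iff fun_apply)
      then show ?case using add add_mem by (simp add: polyfuns_add)
    next
      case (mult p q)
      have "(\<lambda>x. (p * q) x - (p * q) z) = q * (\<lambda>x. p x - p z) + (\<lambda>_. p z) * (\<lambda>x. q x - q z)"
        by (simp add: fun_eq_iff fun_apply algebra_simps)
      moreover have "q * (\<lambda>x. p x - p z) \<in> J" "(\<lambda>_. p z) * (\<lambda>x. q x - q z) \<in> J"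
        using mult mult_mem polyfuns_const by blast+
      ultimately show ?case using mult add_mem by (simp add: polyfuns_mult)
    qed
    then show ?thesis by blast
  qed
  then show ?thesis by blast
qed

end

text \<open>If no power of \<open>h\<close> lies in the ideal \<open>I\<close> of the
  \<open>g a\<close>, Zorn's lemma enlarges \<open>I\<close> to a maximal ideal \<open>J\<close>
  with this property. The point \<open>z\<close> belonging to \<open>J\<close> is a common zero of
  the \<open>g a\<close>, so \<open>h z = 0\<close>, which puts \<open>h\<close> itself into
  \<open>J\<close>.\<close>

theorem nullstellensatz:
  fixes g :: "'a::finite \<Rightarrow> complex ^ 'v::finite \<Rightarrow> complex"
  assumes g: "\<And>a. g a \<in> polyfuns" and h: "h \<in> polyfuns"
    and zero: "\<And>x. (\<And>a. g a x = 0) \<Longrightarrow> h x = 0"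
  shows "\<exists>k q. (\<forall>a. q a \<in> polyfuns) \<and> h ^ k = (\<Sum>a\<in>UNIV. q a * g a)"
proof (rule ccontr)
  assume none: "\<not> ?thesis"
  define I where "I = {\<Sum>a\<in>UNIV. q a * g a | q. \<forall>a. q a \<in> polyfuns}"
  define \<A> where "\<A> = {J. polyfun_ideal J \<and> I \<subseteq> J \<and> (\<forall>k. h ^ k \<notin> J)}"
  have "polyfun_ideal I"
    unfolding polyfun_ideal_def
  proof (intro conjI ballI)
    show "I \<subseteq> polyfuns" using g by (auto simp: I_def intro!: polyfuns_sum polyfuns_mult)
    have "0 = (\<Sum>a\<in>UNIV. 0 * g a)" by simp
    then show "0 \<in> I" unfolding I_def using polyfuns_zero by (intro CollectI exI[of _ "\<lambda>_. 0"]) simp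
  next
    fix p p' assume p: "p \<in> I" and p': "p' \<in> I"
    obtain q where q: "p = (\<Sum>a\<in>UNIV. q a * g a)" "\<forall>a. q a \<in> polyfuns" using p by (auto simp: I_def)
    obtain q' where q': "p' = (\<Sum>a\<in>UNIV. q' a * g a)" "\<forall>a. q' a \<in> polyfuns" using p' by (auto simp: I_def)
    have "p + p' = (\<Sum>a\<in>UNIV. (q a + q' a) * g a)" by (simp add: q q' distrib_right sum.distrib)
    moreover have "\<forall>a. q a + q' a \<in> polyfuns" using q q' polyfuns_add by blast
    ultimately show "p + p' \<in> I"
      unfolding I_def by (intro CollectI exI[of _ "\<lambda>a. q a + q' a"]) simp
  next
    fix p p' :: "complex ^ 'v \<Rightarrow> complex" assume p: "p \<in> polyfuns" and p': "p' \<in> I"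
    obtain q' where q': "p' = (\<Sum>a\<in>UNIV. q' a * g a)" "\<forall>a. q' a \<in> polyfuns" using p' by (auto simp: I_def)
    have "p * p' = (\<Sum>a\<in>UNIV. (p * q' a) * g a)" by (simp add: q' sum_distrib_left mult.assoc)
    moreover have "\<forall>a. p * q' a \<in> polyfuns" using p q' polyfuns_mult by blast
    ultimately show "p * p' \<in> I"
      unfolding I_def by (intro CollectI exI[of _ "\<lambda>a. p * q' a"]) simp
  qed
  then have "I \<in> \<A>" using none by (auto simp: \<A>_def I_def)
  have "\<exists>J\<in>\<A>. \<forall>J'\<in>\<A>. J \<subseteq> J' \<longrightarrow> J' = J"
  proof (rule subset_Zorn_nonempty)
    show "\<A> \<noteq> {}" using \<open>I \<in> \<A>\<close> by blast
  next
    fix C assume C: "C \<noteq> {}" "subset.chain \<A> C"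
    then have sub: "C \<subseteq> \<A>" and tot: "\<And>X Y. X \<in> C \<Longrightarrow> Y \<in> C \<Longrightarrow> X \<subseteq> Y \<or> Y \<subseteq> X"
      by (auto simp: subset.chain_def)
    have "polyfun_ideal (\<Union>C)"
      unfolding polyfun_ideal_def
    proof (intro conjI ballI)
      show "\<Union>C \<subseteq> polyfuns" "0 \<in> \<Union>C"
        using sub C(1) by (auto simp: \<A>_def polyfun_ideal_def)
    next
      fix p q assume "p \<in> \<Union>C" "q \<in> \<Union>C"
      then obtain X where X: "X \<in> C" "p \<in> X" "q \<in> X" using tot by blast
      then have "polyfun_ideal X" using sub by (auto simp: \<A>_def)
      then show "p + q \<in> \<Union>C" using X by (auto simp: polyfun_ideal_def)
    next
      fix p q :: "complex ^ 'v \<Rightarrow> complex" assume p: "p \<in> polyfuns" and "q \<in> \<Union>C"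
      then obtain X where X: "X \<in> C" "q \<in> X" by blast
      then have "polyfun_ideal X" using sub by (auto simp: \<A>_def)
      then show "p * q \<in> \<Union>C" using X p unfolding polyfun_ideal_def by blast
    qed
    then show "\<Union>C \<in> \<A>" using sub C(1) by (auto simp: \<A>_def)
  qed
  then obtain J where J: "J \<in> \<A>" "\<And>J'. J' \<in> \<A> \<Longrightarrow> J \<subseteq> J' \<Longrightarrow> J' = J" by blast
  interpret power_avoiding_ideal J h
  proof
    show "J' = J" if "polyfun_ideal J'" "\<And>k. h ^ k \<notin> J'" "J \<subseteq> J'" for J'
      using J that by (auto simp: \<A>_def)
  qed (use J h in \<open>auto simp: \<A>_def\<close>)
  obtain z where z: "\<And>p. p \<in> polyfuns \<Longrightarrow> (\<lambda>x. p x - p z) \<in> J" using residue_point by blast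
  have "g a z = 0" for a
  proof (rule ccontr)
    assume "g a z \<noteq> 0"
    have "g a = (\<Sum>b\<in>UNIV. (if b = a then 1 else 0) * g b)"
      by (subst sum.cong[OF refl, of _ _ "\<lambda>b. if b = a then g b else 0"]) auto
    moreover have "\<forall>b. (if b = a then 1 else 0 :: complex ^ 'v \<Rightarrow> complex) \<in> polyfuns"
      by (simp add: polyfuns_zero polyfuns_one)
    ultimately have "g a \<in> I"
      unfolding I_def by (intro CollectI exI[of _ "\<lambda>b. if b = a then 1 else 0"]) simp
    then have "g a \<in> J" using J by (auto simp: \<A>_def)
    then have "g a - (\<lambda>x. g a x - g a z) \<in> J" using polyfun_ideal_diff[OF ideal] z g by blast
    moreover have "g a - (\<lambda>x. g a x - g a z) = (\<lambda>_. g a z)" by (simp add: fun_eq_iff fun_apply)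
    ultimately show False using const_notin[OF \<open>g a z \<noteq> 0\<close>] by simp
  qed
  then have "h z = 0" using zero by blast
  then have "h ^ 1 \<in> J" using z[OF h] by simp
  then show False using avoid by blast
qed

section \<open>Homogeneous polynomial functions and the graded Nullstellensatz\<close>

definition homog_polyfuns :: "nat \<Rightarrow> (complex ^ 'v::finite \<Rightarrow> complex) set" where
  "homog_polyfuns t = funs.span (monomial ` {m. sum m UNIV = t})"

lemma homog_polyfuns_subset: "homog_polyfuns t \<subseteq> polyfuns"
  unfolding homog_polyfuns_def polyfuns_def by (rule funs.span_mono) blast

lemma homog_polyfuns_monomial: "sum m UNIV = t \<Longrightarrow> monomial m \<in> homog_polyfuns t"
  unfolding homog_polyfuns_def by (rule funs.span_base) blast

lemma homog_polyfuns_scaling: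
  assumes "p \<in> homog_polyfuns t"
  shows "p (c *s x) = c ^ t * p x"
  using assms[unfolded homog_polyfuns_def]
proof (induction rule: funs.span_induct_alt)
  case base
  then show ?case by (simp add: fun_apply)
next
  case (step a p q)
  then obtain m where m: "p = monomial m" "sum m UNIV = t" by blast
  have "p (c *s x) = c ^ t * p x"
    by (simp add: m(1) power_product_def power_mult_distrib prod.distrib m(2) flip: power_sum)
  then show ?case using step by (simp add: fun_apply algebra_simps)
qed

lemma homog_polyfuns_mult:
  assumes "p \<in> homog_polyfuns s" "q \<in> homog_polyfuns t"
  shows "p * q \<in> homog_polyfuns (s + t)"
proof -
  have mono: "monomial m * q \<in> homog_polyfuns (s + t)" if m: "sum m UNIV = s" for m
    using assms(2)[unfolded homog_polyfuns_def]
  proof (induction rule: funs.span_induct_alt)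
    case base
    then show ?case by (simp add: homog_polyfuns_def funs.span_zero)
  next
    case (step c x y)
    then obtain n where n: "x = monomial n" "sum n UNIV = t" by blast
    have eq: "monomial m * (scale_fun c x + y) = scale_fun c (monomial (\<lambda>i. m i + n i)) + monomial m * y"
      by (simp add: n power_product_add fun_eq_iff fun_apply algebra_simps)
    have "monomial (\<lambda>i. m i + n i) \<in> homog_polyfuns (s + t)"
      using m n by (intro homog_polyfuns_monomial) (simp add: sum.distrib)
    then show ?case
      using step unfolding eq homog_polyfuns_def by (intro funs.span_add funs.span_scale)
  qed
  show ?thesis
    using assms(1)[unfolded homog_polyfuns_def]
  proof (induction rule: funs.span_induct_alt)
    case base
    then show ?case by (simp add: homog_polyfuns_def funs.span_zero)
  next
    case (step c x y)
    have eq: "(scale_fun c x + y) * q = scale_fun c (x * q) + y * q"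
      by (simp add: fun_eq_iff fun_apply algebra_simps)
    have "x * q \<in> homog_polyfuns (s + t)" using step mono by blast
    then show ?case
      using step unfolding eq homog_polyfuns_def by (intro funs.span_add funs.span_scale)
  qed
qed

text \<open>As \<open>P t\<close> is 0 beyond \<open>K\<close>, the component of any prescribed
  degree can be picked, even if it exceeds the degree of \<open>p\<close>.\<close>

lemma homog_decomposition:
  assumes "p \<in> polyfuns"
  shows "\<exists>K P. (\<forall>t. P t \<in> homog_polyfuns t) \<and> (\<forall>t>K. P t = 0) \<and> p = (\<Sum>t\<le>K. P t)"
  using assms[unfolded polyfuns_def]
proof (induction rule: funs.span_induct_alt)
  case base
  show ?case
    by (rule exI[of _ 0], rule exI[of _ "\<lambda>_. 0"]) (simp add: homog_polyfuns_def funs.span_zero)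
next
  case (step c x y)
  then obtain m where m: "x = monomial m" by blast
  obtain K P where P: "\<And>t. P t \<in> homog_polyfuns t" "\<And>t. t > K \<Longrightarrow> P t = 0" "y = (\<Sum>t\<le>K. P t)"
    using step by blast
  define t0 where "t0 = sum m UNIV"
  define P' where "P' t = P t + (if t = t0 then scale_fun c x else 0)" for t
  have "P' t \<in> homog_polyfuns t" for t
  proof -
    have "(if t = t0 then scale_fun c x else 0) \<in> homog_polyfuns t"
      using homog_polyfuns_monomial[of m t0]
      by (auto simp: m t0_def homog_polyfuns_def funs.span_zero funs.span_scale)
    then show ?thesis
      using P(1)[of t] unfolding P'_def homog_polyfuns_def by (intro funs.span_add)
  qed
  moreover have "\<forall>t > max K t0. P' t = 0" using P(2) by (auto simp: P'_def)
  moreover have "(\<Sum>t\<le>max K t0. P' t) = (\<Sum>t\<le>max K t0. P t) + scale_fun c x"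
    by (simp add: P'_def sum.distrib sum.delta)
  moreover have "(\<Sum>t\<le>max K t0. P t) = (\<Sum>t\<le>K. P t)"
    using P(2) by (intro sum.mono_neutral_right) auto
  ultimately show ?case
    using P(3) by (intro exI[of _ "max K t0"] exI[of _ P']) (simp add: add.commute)
qed

text \<open>Both sides at \<open>c *s x\<close> are polynomials in the scalar \<open>c\<close>.
  Comparing the coefficients of \<open>c ^ M\<close> replaces each \<open>q a\<close> by its
  component of degree \<open>M - s\<close>.\<close>

lemma homog_combination:
  fixes g :: "'a::finite \<Rightarrow> complex ^ 'v::finite \<Rightarrow> complex"
  assumes g: "\<And>a. g a \<in> homog_polyfuns s" and h: "h \<in> homog_polyfuns M" and "s \<le> M"
    and q: "\<And>a. q a \<in> polyfuns" and hq: "h = (\<Sum>a\<in>UNIV. q a * g a)"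
  shows "\<exists>q. (\<forall>a. q a \<in> homog_polyfuns (M - s)) \<and> h = (\<Sum>a\<in>UNIV. q a * g a)"
proof -
  obtain K P where P: "\<And>a t. P a t \<in> homog_polyfuns t" "\<And>a t. t > K a \<Longrightarrow> P a t = 0"
    and qP: "\<And>a. q a = (\<Sum>t\<le>K a. P a t)"
    using homog_decomposition[OF q] by metis
  have "h x = (\<Sum>a\<in>UNIV. P a (M - s) x * g a x)" for x
  proof -
    have "poly (monom (h x) M) = poly (\<Sum>a\<in>UNIV. \<Sum>t\<le>K a. monom (P a t x * g a x) (t + s))"
    proof
      fix c
      have "poly (monom (h x) M) c = h (c *s x)"
        using homog_polyfuns_scaling[OF h] by (simp add: poly_monom mult.commute)
      also have "\<dots> = (\<Sum>a\<in>UNIV. \<Sum>t\<le>K a. P a t (c *s x) * g a (c *s x))"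
        by (simp add: hq qP fun_apply sum_distrib_right)
      also have "\<dots> = (\<Sum>a\<in>UNIV. \<Sum>t\<le>K a. (P a t x * g a x) * c ^ (t + s))"
        by (simp add: homog_polyfuns_scaling[OF P(1)] homog_polyfuns_scaling[OF g] power_add mult_ac)
      finally show "poly (monom (h x) M) c = poly (\<Sum>a\<in>UNIV. \<Sum>t\<le>K a. monom (P a t x * g a x) (t + s)) c"
        by (simp add: poly_sum poly_monom)
    qed
    then have "monom (h x) M = (\<Sum>a\<in>UNIV. \<Sum>t\<le>K a. monom (P a t x * g a x) (t + s))"
      by (simp only: poly_eq_poly_eq_iff)
    then have "coeff (monom (h x) M) M = (\<Sum>a\<in>UNIV. \<Sum>t\<le>K a. if t + s = M then P a t x * g a x else 0)"
      by (simp add: coeff_sum)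
    also have "\<dots> = (\<Sum>a\<in>UNIV. P a (M - s) x * g a x)"
    proof (rule sum.cong[OF refl])
      fix a
      have "(\<Sum>t\<le>K a. if t + s = M then P a t x * g a x else 0)
          = (\<Sum>t\<le>K a. if t = M - s then P a t x * g a x else 0)"
        using \<open>s \<le> M\<close> by (intro sum.cong) auto
      also have "\<dots> = P a (M - s) x * g a x"
        using P(2)[of a "M - s"] by (auto simp: sum.delta fun_apply)
      finally show "(\<Sum>t\<le>K a. if t + s = M then P a t x * g a x else 0) = P a (M - s) x * g a x" .
    qed
    finally show ?thesis by simp
  qed
  then have "h = (\<Sum>a\<in>UNIV. P a (M - s) * g a)" by (simp add: fun_eq_iff fun_apply)
  then show ?thesis using P(1) by (intro exI[of _ "\<lambda>a. P a (M - s)"]) simp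
qed

text \<open>Each coordinate vanishes at the only possible common zero, so a power of it is a
  combination of the \<open>g a\<close>, which can be made homogeneous. A common exponent
  \<open>M\<close> serves all coordinates.\<close>

lemma graded_nullstellensatz:
  fixes g :: "'a::finite \<Rightarrow> complex ^ 'v::finite \<Rightarrow> complex"
  assumes g: "\<And>a. g a \<in> homog_polyfuns s"
    and zero: "\<And>x. (\<And>a. g a x = 0) \<Longrightarrow> x = 0"
  shows "\<exists>M\<ge>s. \<forall>b. \<exists>q. (\<forall>a. q a \<in> homog_polyfuns (M - s)) \<and> (\<lambda>x. (x $ b) ^ M) = (\<Sum>a\<in>UNIV. q a * g a)"
proof -
  have "\<exists>k q. (\<forall>a. q a \<in> polyfuns) \<and> (\<lambda>x. x $ b) ^ k = (\<Sum>a\<in>UNIV. q a * g a)" for b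
  proof (rule nullstellensatz)
    show "g a \<in> polyfuns" for a using g homog_polyfuns_subset by blast
    show "x $ b = 0" if "\<And>a. g a x = 0" for x using zero[OF that] by simp
  qed (rule polyfuns_coord)
  then obtain k q where q: "\<And>b a. q b a \<in> polyfuns"
    and kq: "\<And>b. (\<lambda>x. x $ b) ^ k b = (\<Sum>a\<in>UNIV. q b a * g a)"
    by metis
  \<comment> \<open>Large enough for every \<open>k b\<close> and for \<open>s\<close>; the missing
    factor \<open>(x $ b) ^ (M - k b)\<close> is absorbed into the coefficients.\<close>
  define M where "M = s + sum k UNIV"
  have "\<exists>q. (\<forall>a. q a \<in> homog_polyfuns (M - s)) \<and> (\<lambda>x. (x $ b) ^ M) = (\<Sum>a\<in>UNIV. q a * g a)" for b
  proof (rule homog_combination[OF g])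
    show "(\<lambda>x. (x $ b) ^ M) \<in> homog_polyfuns M"
      using homog_polyfuns_monomial[of "\<lambda>j. if j = b then M else 0" M]
      by (simp add: monomial_unit sum.delta)
    show "s \<le> M" by (simp add: M_def)
    show "(\<lambda>x. x $ b) ^ (M - k b) * q b a \<in> polyfuns" for a
      by (intro polyfuns_mult polyfuns_power polyfuns_coord q)
    have "k b \<le> M" by (simp add: M_def member_le_sum trans_le_add2)
    then have pow: "z ^ (M - k b) * z ^ k b = z ^ M" for z :: complex
      by (metis le_add_diff_inverse2 power_add)
    have "(\<lambda>x :: complex ^ 'v. (x $ b) ^ M) = (\<lambda>x. x $ b) ^ (M - k b) * (\<lambda>x. x $ b) ^ k b"
      by (rule ext) (simp only: fun_apply pow)
    also have "\<dots> = (\<Sum>a\<in>UNIV. ((\<lambda>x. x $ b) ^ (M - k b) * q b a) * g a)"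
      unfolding kq sum_distrib_left mult.assoc ..
    finally show "(\<lambda>x. (x $ b) ^ M) = (\<Sum>a\<in>UNIV. ((\<lambda>x. x $ b) ^ (M - k b) * q b a) * g a)" .
  qed
  then show ?thesis by (intro exI[of _ M]) (simp add: M_def)
qed

section \<open>Growth of power products\<close>

text \<open>The span taken modulo functions vanishing on \<open>X\<close>. The members of
  \<open>S\<close> may be any functions and \<open>X\<close> any set, which matters below, where
  neither need be algebraic.\<close>

definition span_on :: "'a set \<Rightarrow> ('a \<Rightarrow> complex) set \<Rightarrow> ('a \<Rightarrow> complex) set" where
  "span_on X S = {f. \<exists>g\<in>funs.span S. \<forall>x\<in>X. f x = g x}"

lemma span_on_zero: "0 \<in> span_on X S"
  unfolding span_on_def using funs.span_zero by blast

lemma span_on_add: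
  assumes "f \<in> span_on X S" "g \<in> span_on X S"
  shows "f + g \<in> span_on X S"
proof -
  obtain f' g' where "f' \<in> funs.span S" "\<forall>x\<in>X. f x = f' x" "g' \<in> funs.span S" "\<forall>x\<in>X. g x = g' x"
    using assms by (auto simp: span_on_def)
  then show ?thesis
    unfolding span_on_def by (intro CollectI bexI[of _ "f' + g'"]) (auto simp: fun_apply funs.span_add)
qed

lemma span_on_scale:
  assumes "f \<in> span_on X S"
  shows "scale_fun c f \<in> span_on X S"
proof -
  obtain f' where "f' \<in> funs.span S" "\<forall>x\<in>X. f x = f' x"
    using assms by (auto simp: span_on_def)
  then show ?thesis
    unfolding span_on_def by (intro CollectI bexI[of _ "scale_fun c f'"]) (auto simp: fun_apply funs.span_scale)
qed

lemma span_on_cong: "f \<in> span_on X S \<Longrightarrow> (\<And>x. x \<in> X \<Longrightarrow> g x = f x) \<Longrightarrow> g \<in> span_on X S"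
  unfolding span_on_def by auto

lemma span_on_base: "f \<in> S \<Longrightarrow> f \<in> span_on X S"
  unfolding span_on_def using funs.span_base by blast

lemma span_on_mono: "S \<subseteq> S' \<Longrightarrow> span_on X S \<subseteq> span_on X S'"
  unfolding span_on_def using funs.span_mono by blast

lemma span_on_multiplier:
  assumes f: "f \<in> span_on X S" and S: "\<And>g. g \<in> S \<Longrightarrow> p * g \<in> span_on X S'"
  shows "p * f \<in> span_on X S'"
proof -
  obtain f' where f': "f' \<in> funs.span S" "\<And>x. x \<in> X \<Longrightarrow> f x = f' x"
    using f by (auto simp: span_on_def)
  have "p * f' \<in> span_on X S'"
    using f'(1)
  proof (induction rule: funs.span_induct_alt)
    case base
    then show ?case by (simp add: span_on_zero)
  next
    case (step c x y)
    have "p * (scale_fun c x + y) = scale_fun c (p * x) + p * y"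
      by (simp add: fun_eq_iff fun_apply algebra_simps)
    then show ?case using step S by (simp add: span_on_add span_on_scale)
  qed
  then show ?thesis by (rule span_on_cong) (simp add: fun_apply f')
qed

lemma power_product_cong: "(\<And>i. i \<in> I \<Longrightarrow> m i = n i) \<Longrightarrow> power_product u I m = power_product u I n"
  by (simp add: power_product_def)

text \<open>For growing \<open>k\<close> these span a filtration of the module generated by
  \<open>B\<close> over the algebra of the \<open>u i\<close> with \<open>i\<close> in
  \<open>I\<close>.\<close>

definition box_products where
  "box_products u I B k = {power_product u I m * b | m b. m \<in> I \<rightarrow>\<^sub>E {..k} \<and> b \<in> B}"

lemma box_productsI:
  assumes "\<And>i. i \<in> I \<Longrightarrow> m i \<le> k" "b \<in> B"
  shows "power_product u I m * b \<in> box_products u I B k"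
proof -
  have "power_product u I m = power_product u I (restrict m I)"
    by (rule power_product_cong) simp
  moreover have "restrict m I \<in> I \<rightarrow>\<^sub>E {..k}" using assms by auto
  ultimately show ?thesis
    using assms(2) unfolding box_products_def
    by (intro CollectI exI[of _ "restrict m I"] exI[of _ b]) simp
qed

lemma box_products_mono: "k \<le> l \<Longrightarrow> box_products u I B k \<subseteq> box_products u I B l"
proof
  fix f assume "k \<le> l" "f \<in> box_products u I B k"
  then obtain m b where "f = power_product u I m * b" "m \<in> I \<rightarrow>\<^sub>E {..k}" "b \<in> B"
    by (auto simp: box_products_def)
  then show "f \<in> box_products u I B l"
    using \<open>k \<le> l\<close> by (metis PiE_mem atMost_iff box_productsI order_trans)
qed

lemma finite_card_box_products:
  assumes "finite I" "finite B"
  shows "finite (box_products u I B k)" "card (box_products u I B k) \<le> Suc k ^ card I * card B"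
proof -
  have eq: "box_products u I B k = (\<lambda>(m, b). power_product u I m * b) ` ((I \<rightarrow>\<^sub>E {..k}) \<times> B)"
    unfolding box_products_def by auto
  have fin: "finite ((I \<rightarrow>\<^sub>E {..k}) \<times> B)" using assms by (simp add: finite_PiE)
  then show "finite (box_products u I B k)" by (simp add: eq)
  have "card (box_products u I B k) \<le> card ((I \<rightarrow>\<^sub>E {..k}) \<times> B)"
    unfolding eq using fin by (rule card_image_le)
  then show "card (box_products u I B k) \<le> Suc k ^ card I * card B"
    using assms by (simp add: card_cartesian_product card_PiE)
qed

lemma power_product_mult_box:
  assumes m: "\<And>i. i \<in> I \<Longrightarrow> m i \<le> l" and f: "f \<in> span_on X (box_products u I B k)"
  shows "power_product u I m * f \<in> span_on X (box_products u I B (l + k))"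
  using f
proof (rule span_on_multiplier)
  fix g assume "g \<in> box_products u I B k"
  then obtain n b where n: "g = power_product u I n * b" "n \<in> I \<rightarrow>\<^sub>E {..k}" "b \<in> B"
    by (auto simp: box_products_def)
  have "power_product u I m * g = power_product u I (\<lambda>i. m i + n i) * b"
    by (simp add: n power_product_add mult.assoc)
  also have "\<dots> \<in> box_products u I B (l + k)"
    using m n by (intro box_productsI) (auto intro!: add_mono dest!: PiE_mem)
  finally show "power_product u I m * g \<in> span_on X (box_products u I B (l + k))" by (rule span_on_base)
qed

text \<open>Power products of the \<open>u i\<close> commute past \<open>p\<close>, so its effect on
  the generators \<open>B\<close> decides. The shift \<open>c\<close> of the level is the same for
  all \<open>k\<close>, which makes levels grow only linearly under powers of
  \<open>p\<close>.\<close>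

lemma box_products_multiplier:
  assumes f: "f \<in> span_on X (box_products u I B k)"
    and B: "\<And>b. b \<in> B \<Longrightarrow> p * b \<in> span_on X (box_products u I B' c)"
  shows "p * f \<in> span_on X (box_products u I B' (k + c))"
  using f
proof (rule span_on_multiplier)
  fix g assume "g \<in> box_products u I B k"
  then obtain n b where n: "g = power_product u I n * b" "n \<in> I \<rightarrow>\<^sub>E {..k}" "b \<in> B"
    by (auto simp: box_products_def)
  have "p * g = power_product u I n * (p * b)" by (simp add: n mult_ac)
  also have "\<dots> \<in> span_on X (box_products u I B' (k + c))"
    using n B by (intro power_product_mult_box) auto
  finally show "p * g \<in> span_on X (box_products u I B' (k + c))" .
qed

text \<open>A substitute for dimension at most \<open>D\<close>: a bound on the growth of the
  functions that polynomials induce on \<open>X\<close>. The constant \<open>C\<close> may depend on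
  the polynomials \<open>f\<close>, but not on \<open>k\<close>.\<close>

definition growth_bounded :: "nat \<Rightarrow> (complex ^ 'v::finite) set \<Rightarrow> bool" where
  "growth_bounded D X \<longleftrightarrow> (\<forall>(d::nat) f. (\<forall>i<d. f i \<in> polyfuns) \<longrightarrow>
     (\<exists>C. \<forall>k. \<exists>S. finite S \<and> card S \<le> C * Suc k ^ D \<and>
        (\<forall>a. (\<forall>i<d. a i \<le> k) \<longrightarrow> power_product f {..<d} a \<in> span_on X S)))"

text \<open>If the coordinates preserve the module up to a shift of level, so do all polynomials. A
  power product with exponents at most \<open>k\<close> then carries 1 to a level linear in
  \<open>k\<close>, and that level is spanned by \<open>O(k ^ card I)\<close> functions.\<close>

lemma growth_bounded_finite_module:
  fixes X :: "(complex ^ 'v::finite) set"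
  assumes fin: "finite I" "finite B"
    and one: "1 \<in> span_on X (box_products u I B k0)"
    and coord: "\<And>i b. b \<in> B \<Longrightarrow> \<exists>c. (\<lambda>x. x $ i) * b \<in> span_on X (box_products u I B c)"
  shows "growth_bounded (card I) X"
proof -
  let ?T = "\<lambda>k. span_on X (box_products u I B k)"
  have mono: "f \<in> ?T l" if "f \<in> ?T k" "k \<le> l" for f k l
    using span_on_mono[OF box_products_mono[OF that(2)]] that(1) by blast
  have poly: "\<exists>c. \<forall>k. \<forall>f\<in>?T k. p * f \<in> ?T (k + c)" if "p \<in> polyfuns" for p
    using that
  proof (induction rule: polyfuns_induct)
    case (const a)
    have "(\<lambda>_. a) * f = scale_fun a f" for f :: "complex ^ 'v \<Rightarrow> complex"
      by (simp add: fun_eq_iff fun_apply)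
    then show ?case by (intro exI[of _ 0]) (simp add: span_on_scale)
  next
    case (coord i)
    have "\<forall>b\<in>B. \<exists>c. (\<lambda>x. x $ i) * b \<in> ?T c" using assms(4) by blast
    from bchoice[OF this] obtain c where c: "\<And>b. b \<in> B \<Longrightarrow> (\<lambda>x. x $ i) * b \<in> ?T (c b)" by blast
    have "(\<lambda>x. x $ i) * b \<in> ?T (sum c B)" if "b \<in> B" for b
      using c[OF that] by (rule mono) (use that fin in \<open>simp add: member_le_sum\<close>)
    then show ?case using box_products_multiplier by blast
  next
    case (add p q)
    then obtain c c' where c: "\<And>k f. f \<in> ?T k \<Longrightarrow> p * f \<in> ?T (k + c)"
      "\<And>k f. f \<in> ?T k \<Longrightarrow> q * f \<in> ?T (k + c')" by blast
    have "(p + q) * f \<in> ?T (k + (c + c'))" if "f \<in> ?T k" for k f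
      unfolding distrib_right
      by (intro span_on_add; rule mono, rule c, rule that) simp_all
    then show ?case by blast
  next
    case (mult p q)
    then obtain c c' where c: "\<And>k f. f \<in> ?T k \<Longrightarrow> p * f \<in> ?T (k + c)"
      "\<And>k f. f \<in> ?T k \<Longrightarrow> q * f \<in> ?T (k + c')" by blast
    have "(p * q) * f \<in> ?T (k + (c' + c))" if "f \<in> ?T k" for k f
      using c(1)[OF c(2)[OF that]] by (simp add: mult.assoc add.assoc)
    then show ?case by blast
  qed
  show ?thesis
    unfolding growth_bounded_def
  proof (intro allI impI)
    fix d :: nat and f :: "nat \<Rightarrow> complex ^ 'v \<Rightarrow> complex"
    assume f: "\<forall>i<d. f i \<in> polyfuns"
    then have "\<forall>i\<in>{..<d}. \<exists>c. \<forall>k. \<forall>h\<in>?T k. f i * h \<in> ?T (k + c)" using poly by blast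
    from bchoice[OF this] obtain c where c: "\<And>i k h. i < d \<Longrightarrow> h \<in> ?T k \<Longrightarrow> f i * h \<in> ?T (k + c i)"
      by blast
    have pow: "f i ^ e * h \<in> ?T (k + e * c i)" if "i < d" "h \<in> ?T k" for i e h k
    proof (induction e)
      case (Suc e)
      have "f i * (f i ^ e * h) \<in> ?T (k + e * c i + c i)" using c Suc that by blast
      then show ?case by (simp add: mult.assoc add_ac)
    qed (use that in simp)
    have prod: "power_product f {..<n} a \<in> ?T (k0 + (\<Sum>i<n. a i * c i))" if "n \<le> d" for n a
      using that
    proof (induction n)
      case 0
      then show ?case using one by (simp add: power_product_def one_fun_def)
    next
      case (Suc n)
      have "power_product f {..<Suc n} a = f n ^ a n * power_product f {..<n} a"
        by (simp add: power_product_def fun_eq_iff fun_apply mult.commute)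
      moreover have "f n ^ a n * power_product f {..<n} a \<in> ?T (k0 + (\<Sum>i<n. a i * c i) + a n * c n)"
        using Suc by (intro pow) simp_all
      ultimately show ?case by (simp add: add_ac)
    qed
    \<comment> \<open>Including \<open>k0\<close> in \<open>L\<close> makes \<open>L * Suc k\<close>
      an upper bound for the level also when \<open>k = 0\<close>.\<close>
    define L where "L = k0 + (\<Sum>i<d. c i)"
    have "finite (box_products u I B (L * Suc k)) \<and>
       card (box_products u I B (L * Suc k)) \<le> (Suc L ^ card I * card B) * Suc k ^ card I \<and>
       (\<forall>a. (\<forall>i<d. a i \<le> k) \<longrightarrow> power_product f {..<d} a \<in> ?T (L * Suc k))" for k
    proof (intro conjI allI impI)
      show "finite (box_products u I B (L * Suc k))" by (rule finite_card_box_products[OF fin])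
      have "Suc (L * Suc k) ^ card I \<le> (Suc L * Suc k) ^ card I" by (intro power_mono) simp_all
      then have "Suc (L * Suc k) ^ card I * card B \<le> (Suc L * Suc k) ^ card I * card B"
        by (rule mult_right_mono) simp
      then show "card (box_products u I B (L * Suc k)) \<le> (Suc L ^ card I * card B) * Suc k ^ card I"
        using finite_card_box_products(2)[OF fin, of u "L * Suc k"]
        by (simp only: power_mult_distrib mult_ac)
    next
      fix a assume a: "\<forall>i<d. a i \<le> k"
      have "(\<Sum>i<d. a i * c i) \<le> (\<Sum>i<d. k * c i)" using a by (intro sum_mono mult_right_mono) auto
      also have "\<dots> = k * (\<Sum>i<d. c i)" by (simp add: sum_distrib_left)
      finally have "k0 + (\<Sum>i<d. a i * c i) \<le> L * Suc k" by (simp add: L_def algebra_simps)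
      then show "power_product f {..<d} a \<in> ?T (L * Suc k)" using mono[OF prod] by blast
    qed
    then show "\<exists>C. \<forall>k. \<exists>S. finite S \<and> card S \<le> C * Suc k ^ card I \<and>
        (\<forall>a. (\<forall>i<d. a i \<le> k) \<longrightarrow> power_product f {..<d} a \<in> span_on X S)"
      by blast
  qed
qed

text \<open>Multiplication by the indicator function of \<open>Y\<close> is linear.\<close>

lemma span_on_restrict:
  assumes "f \<in> span_on X S"
  shows "(\<lambda>x. if x \<in> Y then f x else 0) \<in> span_on X ((\<lambda>g x. if x \<in> Y then g x else 0) ` S)"
proof -
  obtain f' where f': "f' \<in> funs.span S" "\<And>x. x \<in> X \<Longrightarrow> f x = f' x"
    using assms by (auto simp: span_on_def)
  have "(\<lambda>x. if x \<in> Y then f' x else 0) \<in> funs.span ((\<lambda>g x. if x \<in> Y then g x else 0) ` S)"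
    using f'(1)
  proof (induction rule: funs.span_induct_alt)
    case base
    have "(\<lambda>x. if x \<in> Y then (0::'a \<Rightarrow> complex) x else 0) = 0" by (simp add: fun_eq_iff fun_apply)
    then show ?case by (simp add: funs.span_zero)
  next
    case (step c g h)
    have eq: "(\<lambda>x. if x \<in> Y then (scale_fun c g + h) x else 0)
        = scale_fun c (\<lambda>x. if x \<in> Y then g x else 0) + (\<lambda>x. if x \<in> Y then h x else 0)"
      by (auto simp: fun_eq_iff fun_apply)
    show ?case unfolding eq using step by (intro funs.span_add funs.span_scale) (auto intro: funs.span_base)
  qed
  then show ?thesis
    unfolding span_on_def using f'(2)
    by (intro CollectI bexI[of _ "\<lambda>x. if x \<in> Y then f' x else 0"]) auto
qed

text \<open>The spanning functions are cut off to the disjoint sets \<open>X\<close> and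
  \<open>Y - X\<close> and then joined, so the constants add up. The cut-off functions are in
  general not polynomial, which \<open>growth_bounded\<close> permits.\<close>

lemma growth_bounded_Un:
  assumes "growth_bounded D X" "growth_bounded D Y"
  shows "growth_bounded D (X \<union> Y)"
  unfolding growth_bounded_def
proof (intro allI impI)
  fix d :: nat and f :: "nat \<Rightarrow> complex ^ 'a \<Rightarrow> complex"
  assume f: "\<forall>i<d. f i \<in> polyfuns"
  obtain C where C: "\<And>k. \<exists>S. finite S \<and> card S \<le> C * Suc k ^ D \<and>
        (\<forall>a. (\<forall>i<d. a i \<le> k) \<longrightarrow> power_product f {..<d} a \<in> span_on X S)"
    using assms(1) f unfolding growth_bounded_def by metis
  obtain C' where C': "\<And>k. \<exists>S. finite S \<and> card S \<le> C' * Suc k ^ D \<and>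
        (\<forall>a. (\<forall>i<d. a i \<le> k) \<longrightarrow> power_product f {..<d} a \<in> span_on Y S)"
    using assms(2) f unfolding growth_bounded_def by metis
  have "\<exists>S. finite S \<and> card S \<le> (C + C') * Suc k ^ D \<and>
        (\<forall>a. (\<forall>i<d. a i \<le> k) \<longrightarrow> power_product f {..<d} a \<in> span_on (X \<union> Y) S)" for k
  proof -
    obtain S where S: "finite S" "card S \<le> C * Suc k ^ D"
      "\<And>a. (\<forall>i<d. a i \<le> k) \<Longrightarrow> power_product f {..<d} a \<in> span_on X S" using C[of k] by blast
    obtain S' where S': "finite S'" "card S' \<le> C' * Suc k ^ D"
      "\<And>a. (\<forall>i<d. a i \<le> k) \<Longrightarrow> power_product f {..<d} a \<in> span_on Y S'" using C'[of k] by blast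
    let ?r = "\<lambda>Z g x. if x \<in> Z then g x else (0::complex)"
    let ?S = "?r X ` S \<union> ?r (Y - X) ` S'"
    have "card ?S \<le> card S + card S'"
      using card_Un_le[of "?r X ` S" "?r (Y - X) ` S'"] card_image_le[OF S(1), of "?r X"]
        card_image_le[OF S'(1), of "?r (Y - X)"] by linarith
    then have "card ?S \<le> (C + C') * Suc k ^ D" using S S' by (simp add: distrib_right)
    moreover have "power_product f {..<d} a \<in> span_on (X \<union> Y) ?S" if a: "\<forall>i<d. a i \<le> k" for a
    proof -
      let ?f = "power_product f {..<d} a"
      have res: "?r Z ?f \<in> span_on (X \<union> Y) (?r Z ` R)" if W: "?f \<in> span_on W R" "Z \<subseteq> W" for Z W R
      proof -
        obtain h where h: "h \<in> funs.span R" "\<And>x. x \<in> W \<Longrightarrow> ?f x = h x"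
          using W(1) unfolding span_on_def by blast
        then have "h \<in> span_on (X \<union> Y) R" by (auto simp: span_on_def)
        then have "?r Z h \<in> span_on (X \<union> Y) (?r Z ` R)" by (rule span_on_restrict)
        moreover have "?r Z ?f = ?r Z h" using h W(2) by (auto simp: fun_eq_iff)
        ultimately show ?thesis by simp
      qed
      have "?r X ?f \<in> span_on (X \<union> Y) ?S"
        using res[OF S(3)[OF a], of X] span_on_mono[of "?r X ` S" ?S] by blast
      moreover have "?r (Y - X) ?f \<in> span_on (X \<union> Y) ?S"
        using res[OF S'(3)[OF a], of "Y - X"] span_on_mono[of "?r (Y - X) ` S'" ?S] by blast
      ultimately have "?r X ?f + ?r (Y - X) ?f \<in> span_on (X \<union> Y) ?S" by (rule span_on_add)
      then show ?thesis by (rule span_on_cong) (auto simp: fun_apply)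
    qed
    ultimately show ?thesis using S S' by (intro exI[of _ ?S]) simp
  qed
  then show "\<exists>C. \<forall>k. \<exists>S. finite S \<and> card S \<le> C * Suc k ^ D \<and>
        (\<forall>a. (\<forall>i<d. a i \<le> k) \<longrightarrow> power_product f {..<d} a \<in> span_on (X \<union> Y) S)" by blast
qed

lemma growth_bounded_empty: "growth_bounded D {}"
proof -
  have "finite {} \<and> card {} \<le> 0 * Suc k ^ D \<and> power_product f {..<d} a \<in> span_on {} {}"
    for k d a and f :: "nat \<Rightarrow> complex ^ 'a \<Rightarrow> complex"
    using span_on_zero by (auto intro: span_on_cong)
  then show ?thesis unfolding growth_bounded_def by blast
qed

lemma growth_bounded_UN:
  assumes "finite A" "\<And>a. a \<in> A \<Longrightarrow> growth_bounded D (X a)"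
  shows "growth_bounded D (\<Union>a\<in>A. X a)"
  using assms by (induction A) (simp_all add: growth_bounded_empty growth_bounded_Un)

section \<open>Algebras generated by finitely many functions, and integrality\<close>

definition alg_on :: "'a set \<Rightarrow> ('i \<Rightarrow> 'a \<Rightarrow> complex) \<Rightarrow> 'i set \<Rightarrow> ('a \<Rightarrow> complex) set" where
  "alg_on X u I = (\<Union>k. span_on X (box_products u I {1} k))"

lemma alg_on_cong: "f \<in> alg_on X u I \<Longrightarrow> (\<And>x. x \<in> X \<Longrightarrow> g x = f x) \<Longrightarrow> g \<in> alg_on X u I"
  unfolding alg_on_def using span_on_cong by blast

lemma alg_on_mult:
  assumes "f \<in> alg_on X u I" "g \<in> alg_on X u I"
  shows "f * g \<in> alg_on X u I"
proof -
  obtain k l where k: "f \<in> span_on X (box_products u I {1} k)" and l: "g \<in> span_on X (box_products u I {1} l)"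
    using assms by (auto simp: alg_on_def)
  have "f * g \<in> span_on X (box_products u I {1} (l + k))"
    using l by (rule box_products_multiplier) (use k in simp)
  then show ?thesis by (auto simp: alg_on_def)
qed

lemma alg_on_add:
  assumes "f \<in> alg_on X u I" "g \<in> alg_on X u I"
  shows "f + g \<in> alg_on X u I"
proof -
  obtain k l where k: "f \<in> span_on X (box_products u I {1} k)" and l: "g \<in> span_on X (box_products u I {1} l)"
    using assms by (auto simp: alg_on_def)
  have "span_on X (box_products u I {1} k) \<subseteq> span_on X (box_products u I {1} (k + l))"
    "span_on X (box_products u I {1} l) \<subseteq> span_on X (box_products u I {1} (k + l))"
    by (intro span_on_mono box_products_mono; simp)+
  then have "f + g \<in> span_on X (box_products u I {1} (k + l))"
    using k l by (intro span_on_add) auto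
  then show ?thesis by (auto simp: alg_on_def)
qed

lemma alg_on_const: "(\<lambda>_. c) \<in> alg_on X u I"
proof -
  have "power_product u I (\<lambda>_. 0) * 1 \<in> box_products u I {1} 0" by (rule box_productsI) simp_all
  then have "scale_fun c (power_product u I (\<lambda>_. 0) * 1) \<in> alg_on X u I"
    unfolding alg_on_def by (intro UN_I[OF UNIV_I] span_on_scale span_on_base)
  then show ?thesis by (rule alg_on_cong) (simp add: fun_apply power_product_def)
qed

lemma alg_on_generator:
  assumes "finite I" "i \<in> I"
  shows "u i \<in> alg_on X u I"
proof -
  have "power_product u I (\<lambda>j. if j = i then 1 else 0) * 1 \<in> box_products u I {1} 1"
    by (rule box_productsI) simp_all
  then have "power_product u I (\<lambda>j. if j = i then 1 else 0) * 1 \<in> alg_on X u I"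
    unfolding alg_on_def by (intro UN_I[OF UNIV_I] span_on_base)
  then show ?thesis
  proof (rule alg_on_cong)
    fix x
    have "power_product u I (\<lambda>j. if j = i then 1 else 0) x = (\<Prod>j\<in>I. if j = i then u j x else 1)"
      unfolding power_product_def by (rule prod.cong) simp_all
    then show "u i x = (power_product u I (\<lambda>j. if j = i then 1 else 0) * 1) x"
      using assms by (simp add: prod.delta fun_apply)
  qed
qed

lemma alg_on_sum:
  assumes "\<And>a. a \<in> A \<Longrightarrow> f a \<in> alg_on X u I"
  shows "(\<Sum>a\<in>A. f a) \<in> alg_on X u I"
proof -
  have "0 \<in> alg_on X u I" using alg_on_const[of 0 X u I] by (simp add: zero_fun_def)
  then show ?thesis
    using assms by (induction A rule: infinite_finite_induct) (simp_all add: alg_on_add)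
qed

lemma alg_on_diff:
  assumes "f \<in> alg_on X u I" "g \<in> alg_on X u I"
  shows "(\<lambda>x. f x - g x) \<in> alg_on X u I"
proof -
  have "f + (\<lambda>_. -1) * g \<in> alg_on X u I" using assms by (intro alg_on_add alg_on_mult alg_on_const)
  then show ?thesis by (rule alg_on_cong) (simp add: fun_apply)
qed

lemma alg_on_polyfun:
  assumes "p \<in> polyfuns" and w: "\<And>b. (\<lambda>x. w x $ b) \<in> alg_on X u I"
  shows "(\<lambda>x. p (w x)) \<in> alg_on X u I"
  using assms(1)
proof (induction rule: polyfuns_induct)
  case (add p q)
  from alg_on_add[OF this] show ?case by (rule alg_on_cong) (simp add: fun_apply)
next
  case (mult p q)
  from alg_on_mult[OF this] show ?case by (rule alg_on_cong) (simp add: fun_apply)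
qed (simp_all add: alg_on_const w)

text \<open>The coordinates of \<open>y\<close> are integral over the algebra of the
  \<open>u i\<close>, since by the graded Nullstellensatz their \<open>M\<close>-th powers are
  combinations of the \<open>g a\<close> with coefficients of lower degree, and the
  \<open>g a\<close> take values in the algebra along \<open>y\<close>. So finitely many monomials
  in \<open>y\<close> generate a module stable under all coordinates.\<close>

lemma growth_bounded_integral:
  fixes X :: "(complex ^ 'v::finite) set" and y :: "complex ^ 'v \<Rightarrow> complex ^ 'n::finite"
    and g :: "'a::finite \<Rightarrow> complex ^ 'n \<Rightarrow> complex"
  assumes "finite I" and "s \<ge> 1" and g: "\<And>a. g a \<in> homog_polyfuns s"
    and zero: "\<And>x. (\<And>a. g a x = 0) \<Longrightarrow> x = 0"
    and gy: "\<And>a. (\<lambda>v. g a (y v)) \<in> alg_on X u I"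
    and coord: "\<And>i. \<exists>r c b. r \<in> alg_on X u I \<and> (\<forall>v\<in>X. v $ i = r v + c * y v $ b)"
  shows "growth_bounded (card I) X"
proof -
  obtain M where "s \<le> M" and M: "\<And>b. \<exists>q. (\<forall>a. q a \<in> homog_polyfuns (M - s)) \<and>
      (\<lambda>x. (x $ b) ^ M) = (\<Sum>a\<in>UNIV. q a * g a)"
    using graded_nullstellensatz[of g s, OF g zero] by blast
  \<comment> \<open>The reduced monomials: an exponent of at least \<open>M\<close> can be lowered
    by the Nullstellensatz.\<close>
  define E where "E = {m :: 'n \<Rightarrow> nat. \<forall>i. m i < M}"
  define B where "B = (\<lambda>m v. monomial m (y v)) ` E"
  have "E = PiE UNIV (\<lambda>_. {..<M})" by (auto simp: E_def PiE_iff)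
  then have "finite B" by (simp add: B_def finite_PiE)
  let ?T = "\<lambda>k. span_on X (box_products u I B k)"
  have mono: "f \<in> ?T l" if "f \<in> ?T k" "k \<le> l" for f k l
    using span_on_mono[OF box_products_mono[OF that(2)]] that(1) by blast
  have mult_alg: "\<exists>k. r * f \<in> ?T k" if r: "r \<in> alg_on X u I" and f: "f \<in> ?T l" for r f l
  proof -
    obtain k where "r \<in> span_on X (box_products u I {1} k)" using r by (auto simp: alg_on_def)
    \<comment> \<open>Here \<open>f\<close> is the multiplier and \<open>r\<close> the element, in
      the module generated by 1; \<open>f * 1\<close> has level \<open>l\<close>.\<close>
    then have "f * r \<in> ?T (k + l)"
    proof (rule box_products_multiplier)
      show "f * b \<in> ?T l" if "b \<in> {1}" for b using that f by simp
    qed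
    then show ?thesis by (auto simp: mult.commute)
  qed
  have add: "\<exists>k. f + h \<in> ?T k" if fh: "\<exists>k. f \<in> ?T k" "\<exists>k. h \<in> ?T k" for f h
  proof -
    obtain k l where "f \<in> ?T k" "h \<in> ?T l" using fh by blast
    then have "f + h \<in> ?T (k + l)" by (intro span_on_add) (auto intro: mono)
    then show ?thesis by blast
  qed
  have sum: "\<exists>k. (\<Sum>a\<in>A. f a) \<in> ?T k" if "\<And>a. a \<in> A \<Longrightarrow> \<exists>k. f a \<in> ?T k"
    for A :: "'a set" and f
    using that by (induction A rule: infinite_finite_induct) (auto intro: span_on_zero add)
  \<comment> \<open>Strong induction on the degree in \<open>y\<close>: a monomial that is not
    reduced becomes a combination, over the algebra, of polynomials of smaller degree in
    \<open>y\<close>.\<close>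
  have homog: "\<exists>k. (\<lambda>v. p (y v)) \<in> ?T k" if "p \<in> homog_polyfuns t" for p t
    using that
  proof (induction t arbitrary: p rule: less_induct)
    case (less t)
    have mon: "\<exists>k. (\<lambda>v. monomial m (y v)) \<in> ?T k" if m: "sum m UNIV = t" for m
    proof (cases "m \<in> E")
      case True
      then have "power_product u I (\<lambda>_. 0) * (\<lambda>v. monomial m (y v)) \<in> box_products u I B 0"
        by (intro box_productsI) (auto simp: B_def)
      moreover have "power_product u I (\<lambda>_. 0) = 1" by (simp add: power_product_def one_fun_def)
      ultimately show ?thesis using span_on_base by fastforce
    next
      case False
      then obtain b where b: "M \<le> m b" by (auto simp: E_def not_less)
      obtain q where q: "\<And>a. q a \<in> homog_polyfuns (M - s)"
        "(\<lambda>x. (x $ b) ^ M) = (\<Sum>a\<in>UNIV. q a * g a)"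
        using M by blast
      define m' where "m' i = (if i = b then m i - M else m i)" for i
      have m_eq: "m = (\<lambda>i. m' i + (if i = b then M else 0))" using b by (auto simp: m'_def)
      have deg: "sum m' UNIV + M = t"
      proof -
        have "t = sum (\<lambda>i. m' i + (if i = b then M else 0)) UNIV" using m m_eq by simp
        then show ?thesis by (simp add: sum.distrib)
      qed
      have "monomial m = monomial m' * (\<lambda>x. (x $ b) ^ M)"
        by (subst m_eq) (simp only: power_product_add monomial_unit)
      also have "\<dots> = (\<Sum>a\<in>UNIV. g a * (monomial m' * q a))"
        unfolding q(2) sum_distrib_left by (simp only: mult_ac)
      finally have eq: "(\<lambda>v. monomial m (y v)) = (\<Sum>a\<in>UNIV. (\<lambda>v. g a (y v)) * (\<lambda>v. (monomial m' * q a) (y v)))"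
        by (simp add: fun_eq_iff fun_apply)
      show ?thesis
        unfolding eq
      proof (rule sum)
        fix a
        \<comment> \<open>The factor \<open>g a\<close> of degree \<open>s\<close> moves into the
          coefficients, so the degree in \<open>y\<close> falls from \<open>t\<close> to
          \<open>t - s\<close>; hence the requirement \<open>s \<ge> 1\<close>.\<close>
        have "sum m' UNIV + (M - s) < t" using deg \<open>s \<le> M\<close> \<open>s \<ge> 1\<close> by linarith
        moreover have "monomial m' * q a \<in> homog_polyfuns (sum m' UNIV + (M - s))"
          by (intro homog_polyfuns_mult homog_polyfuns_monomial q refl)
        ultimately obtain l where "(\<lambda>v. (monomial m' * q a) (y v)) \<in> ?T l" using less.IH by blast
        then show "\<exists>k. (\<lambda>v. g a (y v)) * (\<lambda>v. (monomial m' * q a) (y v)) \<in> ?T k"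
          by (rule mult_alg[OF gy])
      qed
    qed
    show ?case
      using less.prems[unfolded homog_polyfuns_def]
    proof (induction rule: funs.span_induct_alt)
      case base
      have "(\<lambda>v. (0 :: complex ^ 'n \<Rightarrow> complex) (y v)) = 0" by (simp add: fun_eq_iff fun_apply)
      then show ?case using span_on_zero by metis
    next
      case (step c p q)
      then have "\<exists>k. (\<lambda>v. p (y v)) \<in> ?T k" using mon by blast
      then have "\<exists>k. scale_fun c (\<lambda>v. p (y v)) \<in> ?T k" using span_on_scale by blast
      moreover have "(\<lambda>v. (scale_fun c p + q) (y v)) = scale_fun c (\<lambda>v. p (y v)) + (\<lambda>v. q (y v))"
        by (simp add: fun_eq_iff fun_apply)
      ultimately show ?case using step add by metis
    qed
  qed
  have "\<exists>k. (\<lambda>v. monomial (\<lambda>_. 0) (y v)) \<in> ?T k"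
    by (rule homog[of _ 0], rule homog_polyfuns_monomial) simp
  moreover have "(\<lambda>v. monomial (\<lambda>_. 0) (y v)) = 1" by (simp add: monomial_zero fun_eq_iff fun_apply)
  ultimately obtain k0 where one: "1 \<in> ?T k0" by metis
  show ?thesis
  proof (rule growth_bounded_finite_module[OF \<open>finite I\<close> \<open>finite B\<close> one])
    fix i b assume "b \<in> B"
    then obtain m where m: "b = (\<lambda>v. monomial m (y v))" by (auto simp: B_def)
    obtain r c j where r: "r \<in> alg_on X u I"
      and i: "\<And>v. v \<in> X \<Longrightarrow> v $ i = r v + c * y v $ j"
      using coord[of i] by blast
    obtain l where "b \<in> ?T l" using homog[OF homog_polyfuns_monomial[OF refl]] m by blast
    then have "\<exists>k. r * b \<in> ?T k" by (rule mult_alg[OF r])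
    \<comment> \<open>The summand \<open>c * y v $ j\<close> of the coordinate raises the exponent
      of \<open>j\<close> by one. The new monomial may fail to be reduced, and \<open>homog\<close>
      covers it all the same.\<close>
    moreover have "\<exists>k. scale_fun c (\<lambda>v. monomial (\<lambda>i. m i + (if i = j then 1 else 0)) (y v)) \<in> ?T k"
      using homog[OF homog_polyfuns_monomial[OF refl]] span_on_scale by blast
    ultimately obtain k where k: "r * b + scale_fun c (\<lambda>v. monomial (\<lambda>i. m i + (if i = j then 1 else 0)) (y v)) \<in> ?T k"
      using add by blast
    have "(\<lambda>x. x $ i) * b \<in> ?T k"
      using k by (rule span_on_cong)
        (simp add: fun_apply m i power_product_add monomial_unit algebra_simps)
    then show "\<exists>c. (\<lambda>x. x $ i) * b \<in> ?T c" by blast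
  qed
qed

section \<open>Chains of irreducible closed sets\<close>

lemma mpoly_eval_superset:
  assumes "finite A" "Poly_Mapping.keys p \<subseteq> A"
  shows "mpoly_eval p x = (\<Sum>m\<in>A. Poly_Mapping.lookup p m * monomial (Poly_Mapping.lookup m) x)"
  unfolding mpoly_eval_def power_product_def
  using assms by (intro sum.mono_neutral_left) (auto simp: in_keys_iff)

lemma mpoly_eval_add: "mpoly_eval (p + q) x = mpoly_eval p x + mpoly_eval q x" for x :: "complex ^ 'v::finite"
  using Poly_Mapping.keys_add[of p q]
  by (simp add: mpoly_eval_superset[of "Poly_Mapping.keys p \<union> Poly_Mapping.keys q"]
      lookup_add distrib_right sum.distrib)

lemma mpoly_eval_single: "mpoly_eval (Poly_Mapping.single m c) x = c * monomial (Poly_Mapping.lookup m) x"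
  by (subst mpoly_eval_superset[of "{m}"]) (auto simp: lookup_single)

lemma mpoly_eval_in_polyfuns: "mpoly_eval p \<in> polyfuns"
proof -
  have "mpoly_eval p = (\<Sum>m\<in>Poly_Mapping.keys p. scale_fun (Poly_Mapping.lookup p m) (monomial (Poly_Mapping.lookup m)))"
    by (simp add: fun_eq_iff fun_apply mpoly_eval_superset[OF _ order_refl])
  then show ?thesis by (simp add: polyfuns_sum polyfuns_scale polyfuns_monomial)
qed

lemma polyfuns_mpoly_eval:
  assumes "p \<in> polyfuns"
  shows "\<exists>q. mpoly_eval q = p"
  using assms[unfolded polyfuns_def]
proof (induction rule: funs.span_induct_alt)
  case base
  have "mpoly_eval 0 = (0 :: complex ^ 'a \<Rightarrow> complex)" by (simp add: fun_eq_iff fun_apply mpoly_eval_def)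
  then show ?case by blast
next
  case (step c x y)
  then obtain m q where m: "x = monomial m" and q: "mpoly_eval q = y" by blast
  have "Poly_Mapping.lookup (Abs_poly_mapping m) = m" by (rule Abs_poly_mapping_inverse) simp
  then have "mpoly_eval (Poly_Mapping.single (Abs_poly_mapping m) c + q) = scale_fun c x + y"
    by (simp add: fun_eq_iff fun_apply mpoly_eval_add mpoly_eval_single m q)
  then show ?case by blast
qed

lemma zariski_closed_zeros:
  assumes "p \<in> polyfuns"
  shows "zariski_closed {x. p x = 0}"
proof -
  obtain q where "mpoly_eval q = p" using polyfuns_mpoly_eval[OF assms] by blast
  then have "{x. p x = 0} = {x. \<forall>q\<in>{q}. mpoly_eval q x = 0}" by simp
  then show ?thesis unfolding zariski_closed_def by blast
qed

lemma zariski_closed_separation: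
  assumes "zariski_closed Z" "\<not> W \<subseteq> Z"
  shows "\<exists>p\<in>polyfuns. (\<forall>x\<in>Z. p x = 0) \<and> (\<exists>x\<in>W. p x \<noteq> 0)"
proof -
  obtain P where P: "Z = {x. \<forall>p\<in>P. mpoly_eval p x = 0}" using assms by (auto simp: zariski_closed_def)
  then obtain x p where "x \<in> W" "p \<in> P" "mpoly_eval p x \<noteq> 0" using assms(2) by blast
  then show ?thesis using P mpoly_eval_in_polyfuns[of p] by blast
qed

text \<open>The zero sets of the factors cover \<open>Z\<close>, so one of them contains it: the
  polynomial functions on \<open>Z\<close> form a domain.\<close>

lemma zariski_irreducible_mult:
  assumes "zariski_irreducible Z" "p \<in> polyfuns" "q \<in> polyfuns"
    and "\<And>x. x \<in> Z \<Longrightarrow> p x * q x = 0" and "\<exists>x\<in>Z. p x \<noteq> 0"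
  shows "\<forall>x\<in>Z. q x = 0"
proof -
  have "Z \<subseteq> {x. p x = 0} \<union> {x. q x = 0}" using assms(4) by auto
  then have "Z \<subseteq> {x. p x = 0} \<or> Z \<subseteq> {x. q x = 0}"
    using assms(1) zariski_closed_zeros[OF assms(2)] zariski_closed_zeros[OF assms(3)]
    unfolding zariski_irreducible_def by blast
  then show ?thesis using assms(5) by auto
qed

lemma polyfuns_power_product:
  assumes "\<And>i. i \<in> I \<Longrightarrow> f i \<in> polyfuns"
  shows "power_product f I a \<in> polyfuns"
proof -
  have "power_product f I a = (\<Prod>i\<in>I. f i ^ a i)"
    by (simp add: power_product_def fun_eq_iff fun_apply)
  then show ?thesis using assms by (simp add: polyfuns_prod polyfuns_power)
qed

text \<open>
  A relation is expanded in powers of the last polynomial. Restricting to the last but one set kills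
  all terms except the constant one, which is zero by induction; by irreducibility the last
  polynomial can then be cancelled.
\<close>

lemma chain_algebraically_independent:
  assumes "\<And>i. i \<le> d \<Longrightarrow> zariski_irreducible (Z i)" "\<And>i. i < d \<Longrightarrow> Z i \<subseteq> Z (Suc i)"
    and "\<And>i. i < d \<Longrightarrow> f i \<in> polyfuns" "\<And>i x. i < d \<Longrightarrow> x \<in> Z i \<Longrightarrow> f i x = 0"
    and "\<And>i. i < d \<Longrightarrow> \<exists>x\<in>Z (Suc i). f i x \<noteq> 0"
    and "\<And>x. x \<in> Z d \<Longrightarrow> (\<Sum>a\<in>{..<d} \<rightarrow>\<^sub>E {..k}. c a * power_product f {..<d} a x) = 0"
  shows "\<forall>a\<in>{..<d} \<rightarrow>\<^sub>E {..k}. c a = 0"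
  using assms
proof (induction d arbitrary: c)
  case 0
  obtain x where "x \<in> Z 0" using 0(1)[of 0] by (auto simp: zariski_irreducible_def)
  then show ?case using 0(6)[of x] by (simp add: power_product_def)
next
  case (Suc d)
  let ?A = "{..<d} \<rightarrow>\<^sub>E {..k}"
  let ?P = "\<lambda>e x. \<Sum>b\<in>?A. e b * power_product f {..<d} b x"
  have IH: "\<forall>b\<in>?A. e b = 0" if "\<And>x. x \<in> Z d \<Longrightarrow> ?P e x = 0" for e :: "(nat \<Rightarrow> nat) \<Rightarrow> complex"
    using Suc.prems that by (intro Suc.IH) simp_all
  have poly: "?P e \<in> polyfuns" for e
  proof -
    have "?P e = (\<Sum>b\<in>?A. scale_fun (e b) (power_product f {..<d} b))"
      by (simp add: fun_eq_iff fun_apply)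
    then show ?thesis
      using Suc.prems(3) by (auto intro!: polyfuns_sum polyfuns_scale polyfuns_power_product)
  qed
  \<comment> \<open>The relation as a polynomial of degree \<open>l\<close> in \<open>f d\<close>.
    It is stated for arbitrary \<open>l\<close> and \<open>e\<close>, so that after removing the
    constant term and cancelling \<open>f d\<close> the shifted coefficients
    \<open>e (Suc s)\<close> are covered by induction.\<close>
  have fin: "\<forall>s\<le>l. \<forall>b\<in>?A. e s b = 0"
    if "\<And>x. x \<in> Z (Suc d) \<Longrightarrow> (\<Sum>s\<le>l. f d x ^ s * ?P (e s) x) = 0" for e :: "nat \<Rightarrow> (nat \<Rightarrow> nat) \<Rightarrow> complex" and l
    using that
  proof (induction l arbitrary: e)
    case l: 0
    have "\<forall>b\<in>?A. e 0 b = 0"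
      using l Suc.prems(2)[of d] by (intro IH) (auto simp del: PiE_iff)
    then show ?case by simp
  next
    case l: (Suc l)
    have split: "(\<Sum>s\<le>Suc l. f d x ^ s * ?P (e s) x) = ?P (e 0) x + f d x * (\<Sum>s\<le>l. f d x ^ s * ?P (e (Suc s)) x)" for x
      by (simp only: sum.atMost_Suc_shift) (simp add: sum_distrib_left mult.assoc)
    have e0: "\<forall>b\<in>?A. e 0 b = 0"
    proof (rule IH)
      fix x assume "x \<in> Z d"
      then show "?P (e 0) x = 0"
        using l.prems[of x] Suc.prems(2)[of d] Suc.prems(4)[of d x] unfolding split by auto
    qed
    have "\<forall>x\<in>Z (Suc d). (\<Sum>s\<le>l. f d x ^ s * ?P (e (Suc s)) x) = 0"
    proof (rule zariski_irreducible_mult)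
      show "zariski_irreducible (Z (Suc d))" "f d \<in> polyfuns" "\<exists>x\<in>Z (Suc d). f d x \<noteq> 0"
        using Suc.prems by simp_all
      have "(\<lambda>x. \<Sum>s\<le>l. f d x ^ s * ?P (e (Suc s)) x) = (\<Sum>s\<le>l. f d ^ s * ?P (e (Suc s)))"
        by (simp add: fun_eq_iff fun_apply)
      then show "(\<lambda>x. \<Sum>s\<le>l. f d x ^ s * ?P (e (Suc s)) x) \<in> polyfuns"
        using \<open>f d \<in> polyfuns\<close> poly by (simp only: polyfuns_sum polyfuns_mult polyfuns_power)
      show "f d x * (\<Sum>s\<le>l. f d x ^ s * ?P (e (Suc s)) x) = 0" if "x \<in> Z (Suc d)" for x
        using l.prems[OF that] e0 unfolding split by simp
    qed
    then have "\<forall>s\<le>l. \<forall>b\<in>?A. e (Suc s) b = 0" by (intro l.IH) blast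
    then show ?case using e0 by (metis le_SucE Suc_le_mono not0_implies_Suc)
  qed
  \<comment> \<open>The exponent vectors are grouped by their last entry \<open>s\<close>.\<close>
  have "(\<Sum>s\<le>k. f d x ^ s * ?P (\<lambda>b. c (b(d := s))) x)
      = (\<Sum>a\<in>{..<Suc d} \<rightarrow>\<^sub>E {..k}. c a * power_product f {..<Suc d} a x)" for x
  proof -
    have pp: "power_product f {..<Suc d} (b(d := s)) x = f d x ^ s * power_product f {..<d} b x" for b s
    proof -
      have "(\<Prod>i<d. f i x ^ (b(d := s)) i) = (\<Prod>i<d. f i x ^ b i)" by (rule prod.cong) simp_all
      then show ?thesis by (simp add: power_product_def mult.commute)
    qed
    let ?F = "\<lambda>(s, b). b(d := s) :: nat \<Rightarrow> nat"
    have image: "{..<Suc d} \<rightarrow>\<^sub>E {..k} = ?F ` ({..k} \<times> ?A)"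
      by (simp add: lessThan_Suc PiE_insert_eq)
    have inj: "inj_on ?F ({..k} \<times> ?A)"
      using inj_combinator[of d "{..<d}" "\<lambda>_. {..k}"] by simp
    have "(\<Sum>a\<in>{..<Suc d} \<rightarrow>\<^sub>E {..k}. c a * power_product f {..<Suc d} a x)
        = (\<Sum>p\<in>{..k} \<times> ?A. c (?F p) * power_product f {..<Suc d} (?F p) x)"
      unfolding image sum.reindex[OF inj] by (rule sum.cong[OF refl]) (rule comp_apply)
    also have "\<dots> = (\<Sum>(s, b)\<in>{..k} \<times> ?A. c (b(d := s)) * power_product f {..<Suc d} (b(d := s)) x)"
      by (simp only: case_prod_unfold)
    also have "\<dots> = (\<Sum>(s, b)\<in>{..k} \<times> ?A. f d x ^ s * (c (b(d := s)) * power_product f {..<d} b x))"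
      by (simp only: pp mult.left_commute)
    also have "\<dots> = (\<Sum>s\<le>k. \<Sum>b\<in>?A. f d x ^ s * (c (b(d := s)) * power_product f {..<d} b x))"
      by (rule sum.cartesian_product[symmetric])
    finally show ?thesis by (simp only: sum_distrib_left)
  qed
  then have *: "\<forall>s\<le>k. \<forall>b\<in>?A. c (b(d := s)) = 0"
    using Suc.prems(6) by (intro fin) simp
  show ?case
  proof
    fix a assume "a \<in> {..<Suc d} \<rightarrow>\<^sub>E {..k}"
    then have "a \<in> (\<lambda>(s, b). b(d := s)) ` ({..k} \<times> ?A)"
      by (simp add: lessThan_Suc PiE_insert_eq)
    then show "c a = 0" using * by auto
  qed
qed

text \<open>For \<open>d > D\<close> the independent power products, \<open>(k + 1) ^ d\<close> in
  number, would outgrow the bound \<open>C * (k + 1) ^ D\<close>.\<close>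

lemma chain_length_le:
  assumes X: "growth_bounded D X"
    and Z: "\<And>i. i \<le> d \<Longrightarrow> zariski_closed (Z i) \<and> zariski_irreducible (Z i) \<and> Z i \<subseteq> X"
    and strict: "\<And>i. i < d \<Longrightarrow> Z i \<subset> Z (Suc i)"
  shows "d \<le> D"
proof (rule ccontr)
  assume "\<not> d \<le> D"
  have "\<exists>p. i < d \<longrightarrow> p \<in> polyfuns \<and> (\<forall>x\<in>Z i. p x = 0) \<and> (\<exists>x\<in>Z (Suc i). p x \<noteq> 0)" for i
  proof (cases "i < d")
    case True
    then have "zariski_closed (Z i)" "\<not> Z (Suc i) \<subseteq> Z i" using Z[of i] strict[of i] by auto
    then show ?thesis using zariski_closed_separation by blast
  qed simp
  then obtain f where f: "\<And>i. i < d \<Longrightarrow> f i \<in> polyfuns" "\<And>i x. i < d \<Longrightarrow> x \<in> Z i \<Longrightarrow> f i x = 0"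
    "\<And>i. i < d \<Longrightarrow> \<exists>x\<in>Z (Suc i). f i x \<noteq> 0"
    by metis
  have "\<exists>C. \<forall>k. \<exists>S. finite S \<and> card S \<le> C * Suc k ^ D \<and>
        (\<forall>a. (\<forall>i<d. a i \<le> k) \<longrightarrow> power_product f {..<d} a \<in> span_on X S)"
    using X f(1) unfolding growth_bounded_def by blast
  \<comment> \<open>The bound is used at \<open>k = C\<close>, which suffices because
    \<open>C * Suc C ^ D < Suc C ^ Suc D\<close>.\<close>
  then obtain C S where S: "finite S" "card S \<le> C * Suc C ^ D"
    "\<And>a. (\<forall>i<d. a i \<le> C) \<Longrightarrow> power_product f {..<d} a \<in> span_on X S"
    by blast
  let ?A = "{..<d} \<rightarrow>\<^sub>E {..C}"
  have "C * Suc C ^ D < Suc C ^ Suc D" by simp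
  also have "\<dots> \<le> Suc C ^ d" using \<open>\<not> d \<le> D\<close> by (intro power_increasing) simp_all
  finally have card: "card S < card ?A" using S(2) by (simp add: card_PiE)
  have "\<exists>q. a \<in> ?A \<longrightarrow> q \<in> funs.span S \<and> (\<forall>x\<in>X. power_product f {..<d} a x = q x)" for a
    using S(3)[of a] by (auto simp: span_on_def dest: PiE_mem)
  then obtain q where q: "\<And>a. a \<in> ?A \<Longrightarrow> q a \<in> funs.span S"
    "\<And>a x. a \<in> ?A \<Longrightarrow> x \<in> X \<Longrightarrow> power_product f {..<d} a x = q a x"
    by metis
  obtain c a0 where c: "a0 \<in> ?A" "c a0 \<noteq> 0" "\<And>x. (\<Sum>a\<in>?A. c a * q a x) = 0"
    using dependent_family[of S ?A q, OF S(1) _ card q(1)] by (auto simp: finite_PiE)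
  have "\<forall>a\<in>?A. c a = 0"
  proof (rule chain_algebraically_independent[of d Z f])
    fix x assume "x \<in> Z d"
    then have "x \<in> X" using Z by blast
    then have "(\<Sum>a\<in>?A. c a * power_product f {..<d} a x) = (\<Sum>a\<in>?A. c a * q a x)"
      using q(2) by (intro sum.cong) auto
    then show "(\<Sum>a\<in>?A. c a * power_product f {..<d} a x) = 0" using c(3) by simp
  qed (use Z strict f in auto)
  then show False using c by blast
qed

text \<open>The growth bound is asked of a larger set \<open>Y\<close>, which need not be
  closed.\<close>

lemma zariski_dim_le_growth:
  assumes "growth_bounded D Y" "X \<subseteq> Y"
  shows "zariski_dim X \<le> D"
proof -
  let ?L = "{d. \<exists>Z. (\<forall>i\<le>d. zariski_closed (Z i) \<and> zariski_irreducible (Z i) \<and> Z i \<subseteq> X)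
                                \<and> (\<forall>i<d. Z i \<subset> Z (Suc i))}"
  have "d \<le> D" if d: "d \<in> ?L" for d
  proof -
    obtain Z where Z: "\<And>i. i \<le> d \<Longrightarrow> zariski_closed (Z i) \<and> zariski_irreducible (Z i) \<and> Z i \<subseteq> X"
      "\<And>i. i < d \<Longrightarrow> Z i \<subset> Z (Suc i)"
      using d by blast
    show ?thesis
    proof (rule chain_length_le[OF assms(1)])
      show "zariski_closed (Z i) \<and> zariski_irreducible (Z i) \<and> Z i \<subseteq> Y" if "i \<le> d" for i
        using Z(1)[OF that] assms(2) by blast
    qed (rule Z(2))
  qed
  then have "Sup ?L \<le> D"
  \<comment> \<open>If \<open>X\<close> contains no irreducible closed set, as when it is empty, the
    supremum is that of the empty set, which is 0 in \<open>nat\<close>.\<close>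
  proof (cases "?L = {}")
    case True
    then show ?thesis by (simp only: Sup_nat_empty)
  next
    case False
    then show ?thesis using \<open>\<And>d. d \<in> ?L \<Longrightarrow> d \<le> D\<close> by (rule cSup_least)
  qed
  then show ?thesis by (simp add: zariski_dim_def)
qed

section \<open>The Birch locus of the difference map\<close>

text \<open>For \<open>m k = 0\<close> the truncated exponent \<open>m k - 1\<close> does no harm,
  as the factor \<open>of_nat (m k)\<close> vanishes.\<close>

lemma monomial_axis_derivative:
  "((\<lambda>t. monomial m (x + axis k t)) has_field_derivative of_nat (m k) * monomial (m(k := m k - 1)) x) (at 0)"
proof -
  define P where "P = (\<Prod>j\<in>UNIV - {k}. (x $ j) ^ m j)"
  have "monomial m (x + axis k t) = (x $ k + t) ^ m k * P" for t
  proof -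
    have "(\<Prod>j\<in>UNIV - {k}. ((x + axis k t) $ j) ^ m j) = P"
      unfolding P_def by (rule prod.cong) (simp_all add: axis_def)
    then show ?thesis
      by (simp add: power_product_def prod.remove[of UNIV k] axis_def)
  qed
  moreover have "monomial (m(k := m k - 1)) x = (x $ k) ^ (m k - 1) * P"
  proof -
    have "(\<Prod>j\<in>UNIV - {k}. (x $ j) ^ (m(k := m k - 1)) j) = P"
      unfolding P_def by (rule prod.cong) simp_all
    then show ?thesis by (simp add: power_product_def prod.remove[of UNIV k])
  qed
  moreover have "((\<lambda>t. (x $ k + t) ^ m k * P) has_field_derivative of_nat (m k) * ((x $ k) ^ (m k - 1) * P)) (at 0)"
    by (auto intro!: derivative_eq_intros)
  ultimately show ?thesis by simp
qed

lemma mpoly_eval_axis_derivative: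
  "((\<lambda>t. mpoly_eval p (x + axis k t)) has_field_derivative
     (\<Sum>m\<in>Poly_Mapping.keys p. Poly_Mapping.lookup p m * (of_nat (Poly_Mapping.lookup m k) *
        monomial ((Poly_Mapping.lookup m)(k := Poly_Mapping.lookup m k - 1)) x))) (at 0)"
  unfolding mpoly_eval_superset[OF finite_keys order_refl]
  by (intro DERIV_sum DERIV_cmult monomial_axis_derivative)

lemma int_form_axis_derivative:
  "((\<lambda>t. int_form Q (x + axis k t)) has_field_derivative gradient (int_form Q) x $ k) (at 0)"
proof -
  note d = mpoly_eval_axis_derivative[of "Poly_Mapping.map of_int Q" x k]
  show ?thesis
    using d unfolding gradient_def int_form_def by (simp add: DERIV_imp_deriv[OF d])
qed

lemma gradient_homogeneous:
  assumes "homogeneous r Q"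
  shows "(\<lambda>x. gradient (int_form Q) x $ k) \<in> homog_polyfuns (r - 1)"
proof -
  define p :: "('a, complex) mpoly" where "p = Poly_Mapping.map of_int Q"
  have keys: "Poly_Mapping.keys p \<subseteq> Poly_Mapping.keys Q"
    unfolding p_def by (auto simp: in_keys_iff Poly_Mapping.map.rep_eq when_def)
  have "(\<lambda>x. gradient (int_form Q) x $ k) = (\<Sum>m\<in>Poly_Mapping.keys p. scale_fun (Poly_Mapping.lookup p m)
      (scale_fun (of_nat (Poly_Mapping.lookup m k))
        (monomial ((Poly_Mapping.lookup m)(k := Poly_Mapping.lookup m k - 1)))))"
    by (simp add: fun_eq_iff fun_apply gradient_def int_form_def DERIV_imp_deriv[OF mpoly_eval_axis_derivative] mult.assoc flip: p_def)
  also have "\<dots> \<in> homog_polyfuns (r - 1)"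
    unfolding homog_polyfuns_def
  proof (rule funs.span_sum)
    fix m assume m: "m \<in> Poly_Mapping.keys p"
    let ?m = "Poly_Mapping.lookup m"
    have sum: "sum ?m UNIV = r" using m keys assms by (auto simp: homogeneous_def)
    have "scale_fun (of_nat (?m k)) (monomial (?m(k := ?m k - 1))) \<in> funs.span (monomial ` {m. sum m UNIV = r - 1})"
    \<comment> \<open>In the first case the monomial is unchanged and has degree \<open>r\<close>,
      but its coefficient is 0.\<close>
    proof (cases "?m k = 0")
      case True
      have "scale_fun (of_nat (?m k)) (monomial (?m(k := ?m k - 1))) = 0"
        by (simp add: True fun_eq_iff fun_apply)
      then show ?thesis using funs.span_zero by metis
    next
      case False
      have "sum (?m(k := ?m k - 1)) (UNIV - {k}) = sum ?m (UNIV - {k})" by (rule sum.cong) simp_all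
      then have "sum (?m(k := ?m k - 1)) UNIV = r - 1"
        using sum False by (simp add: sum.remove[of UNIV k])
      then show ?thesis by (intro funs.span_scale funs.span_base) blast
    qed
    then show "scale_fun (Poly_Mapping.lookup p m) (scale_fun (of_nat (?m k)) (monomial (?m(k := ?m k - 1))))
        \<in> funs.span (monomial ` {m. sum m UNIV = r - 1})"
      by (rule funs.span_scale)
  qed
  finally show ?thesis .
qed

text \<open>Without a relation the rows would be independent and the row rank would equal their
  number. As \<open>rows A\<close> is a set, it must also be shown that no two rows
  coincide.\<close>

lemma rank_deficient_rows_dependent:
  fixes A :: "'a::field ^ 'n::finite ^ 'm::finite"
  assumes "rank A < CARD('m)"
  shows "\<exists>c. (\<exists>e. c e \<noteq> 0) \<and> (\<forall>k. (\<Sum>e\<in>UNIV. c e * A $ e $ k) = 0)"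
proof (rule ccontr)
  assume none: "\<not> ?thesis"
  have ind: "\<forall>e. c e = 0" if c: "(\<Sum>e\<in>UNIV. c e *s row e A) = 0" for c
  proof -
    have "(\<Sum>e\<in>UNIV. c e * A $ e $ k) = 0" for k
      using arg_cong[OF c, of "\<lambda>v. v $ k"] by (simp add: row_def)
    then show ?thesis using none by blast
  qed
  have inj: "inj (\<lambda>e. row e A)"
  proof (rule injI, rule ccontr)
    fix a b assume ab: "row a A = row b A" "a \<noteq> b"
    define c where "c = (\<lambda>x. if x = a then 1 else if x = b then -1 else (0::'a))"
    have "(\<Sum>e\<in>UNIV. c e *s row e A) = (\<Sum>e\<in>{a, b}. c e *s row e A)"
      by (rule sum.mono_neutral_right) (auto simp: c_def)
    also have "\<dots> = 0" using ab by (simp add: c_def)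
    finally have "c a = 0" using ind by blast
    then show False by (simp add: c_def)
  qed
  have rows: "rows A = range (\<lambda>e. row e A)" by (auto simp: rows_def)
  have "vec.independent (rows A)"
    unfolding rows
  proof (rule vec.independent_if_scalars_zero)
    fix f v assume "(\<Sum>v\<in>range (\<lambda>e. row e A). f v *s v) = 0" "v \<in> range (\<lambda>e. row e A)"
    then show "f v = 0" using ind[of "\<lambda>e. f (row e A)"] by (auto simp: sum.reindex[OF inj])
  qed simp
  then have "rank A = card (rows A)" by (simp add: row_rank_def_gen vec.dim_eq_card_independent)
  also have "\<dots> = CARD('m)" by (simp add: rows card_image[OF inj])
  finally show False using assms by simp
qed

lemma component_axis: "component (v + axis (j, a) t) i = component v i + (if i = j then axis a t else 0)"
  by (auto simp: component_def vec_eq_iff axis_def)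

text \<open>Moving the coordinate \<open>(j, a)\<close> shifts the difference of the components
  \<open>p\<close> and \<open>q\<close> along the axis \<open>a\<close>: forwards for
  \<open>j = p\<close>, backwards for \<open>j = q\<close>, and otherwise not at all.\<close>

lemma Jac_difference_map:
  fixes v :: "complex ^ ('m::{card2,linorder} \<times> 'n::finite)"
  assumes e: "Rep_lt_pair e = (p, q)"
  shows "Jac (difference_map Q) v $ e $ (j, a) =
    (if p = j then gradient (int_form Q) (component v p - component v q) $ a
     else if q = j then - (gradient (int_form Q) (component v p - component v q) $ a) else 0)"
proof -
  let ?w = "component v p - component v q" and ?g = "\<lambda>x. int_form Q x :: complex"
  have "p < q" using Rep_lt_pair[of e] e by simp
  have Jac: "Jac (difference_map Q) v $ e $ (j, a) =
      deriv (\<lambda>t. ?g (?w + ((if p = j then axis a t else 0) - (if q = j then axis a t else 0)))) 0"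
    by (simp add: Jac_def gradient_def difference_map_def e component_axis algebra_simps)
  have neg: "((\<lambda>t. ?g (?w - axis a t)) has_field_derivative - (gradient (int_form Q) ?w $ a)) (at 0)"
  proof -
    have "((\<lambda>t. ?g (?w + axis a t)) \<circ> uminus has_field_derivative gradient (int_form Q) ?w $ a * -1) (at 0)"
      by (rule DERIV_chain) (auto intro!: int_form_axis_derivative derivative_eq_intros)
    moreover have "?w + axis a (- t) = ?w - axis a t" for t by (simp add: vec_eq_iff axis_def)
    ultimately show ?thesis by (simp add: comp_def)
  qed
  show ?thesis
    unfolding Jac using \<open>p < q\<close> DERIV_imp_deriv[OF neg]
      DERIV_imp_deriv[OF int_form_axis_derivative[of Q ?w a]]
    by auto
qed

text \<open>These loci need not be closed, as the coefficients \<open>c\<close> may be unbounded on them.\<close>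

definition relation_locus :: "('n::finite, int) mpoly \<Rightarrow> 'm::{card2,linorder} lt_pair \<Rightarrow> (complex ^ ('m \<times> 'n)) set" where
  "relation_locus Q e0 = {v. \<exists>c. c e0 = 1 \<and> (\<forall>k. (\<Sum>e\<in>UNIV. c e * Jac (difference_map Q) v $ e $ k) = 0)}"

text \<open>Dividing a relation by one of its nonzero coefficients gives a cover by finitely many
  sets, which \<open>growth_bounded_UN\<close> can handle.\<close>

lemma birch_locus_difference_map: "birch_locus (difference_map Q) \<subseteq> (\<Union>e0. relation_locus Q e0)"
proof
  fix v assume "v \<in> birch_locus (difference_map Q)"
  then obtain c e0 where c: "c e0 \<noteq> 0" "\<And>k. (\<Sum>e\<in>UNIV. c e * Jac (difference_map Q) v $ e $ k) = 0"
    using rank_deficient_rows_dependent unfolding birch_locus_def by blast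
  have "(\<Sum>e\<in>UNIV. c e / c e0 * Jac (difference_map Q) v $ e $ k) = 0" for k
    using c(2)[of k] by (simp add: sum_divide_distrib[symmetric])
  then have "v \<in> relation_locus Q e0"
    unfolding relation_locus_def using c(1) by (intro CollectI exI[of _ "\<lambda>e. c e / c e0"]) simp
  then show "v \<in> (\<Union>e0. relation_locus Q e0)" by blast
qed

text \<open>The generators are the coordinates of all components but \<open>p0\<close> and the
  coefficients of all pairs but \<open>e0\<close>, whose number is the bound. The partial
  derivatives of \<open>Q\<close>, of degree \<open>r - 1\<close>, make the difference of the
  components \<open>p0\<close> and \<open>q0\<close> integral over them.\<close>

lemma growth_bounded_relation_locus:
  fixes Q :: "('n::finite, int) mpoly" and e0 :: "'m::{card2,linorder} lt_pair"
  assumes "r \<ge> 2" and hom: "homogeneous r Q" and ns: "nonsingular_form Q"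
  shows "growth_bounded ((CARD('m) - 1) * CARD('n) + (CARD('m lt_pair) - 1)) (relation_locus Q e0)"
proof -
  define X where "X = relation_locus Q e0"
  obtain p0 q0 where e0: "Rep_lt_pair e0 = (p0, q0)" by fastforce
  then have "p0 < q0" using Rep_lt_pair[of e0] by simp
  have "\<forall>v\<in>X. \<exists>c. c e0 = 1 \<and> (\<forall>k. (\<Sum>e\<in>UNIV. c e * Jac (difference_map Q) v $ e $ k) = 0)"
    by (auto simp: X_def relation_locus_def)
  \<comment> \<open>The coefficients become functions of \<open>v\<close> by mere choice, so they
    need have no regularity.\<close>
  from bchoice[OF this] obtain c where c: "\<And>v. v \<in> X \<Longrightarrow> c v e0 = 1"
    "\<And>v k. v \<in> X \<Longrightarrow> (\<Sum>e\<in>UNIV. c v e * Jac (difference_map Q) v $ e $ k) = 0"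
    by blast
  define u where "u = case_sum (\<lambda>k v. v $ k) (\<lambda>e v. c v e)"
  define I :: "('m \<times> 'n + 'm lt_pair) set" where "I = ((- {p0}) \<times> UNIV) <+> (- {e0})"
  let ?A = "alg_on X u I"
  have "finite I" by simp
  have coord: "(\<lambda>v. component v k $ b) \<in> ?A" if "k \<noteq> p0" for k b
  proof -
    have "Inl (k, b) \<in> I" using that by (auto simp: I_def)
    from alg_on_generator[OF \<open>finite I\<close> this, of u X] show ?thesis by (simp add: u_def component_def)
  qed
  have coeff: "(\<lambda>v. c v e) \<in> ?A" if "e \<noteq> e0" for e
  proof -
    have "Inr e \<in> I" using that by (auto simp: I_def)
    from alg_on_generator[OF \<open>finite I\<close> this, of u X] show ?thesis by (simp add: u_def)
  qed
  let ?g = "\<lambda>a x. gradient (int_form Q) x $ a"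
  have hom_g: "?g a \<in> homog_polyfuns (r - 1)" for a by (rule gradient_homogeneous[OF hom])
  have diff: "(\<lambda>v. ?g a (component v p - component v q)) \<in> ?A" if "p \<noteq> p0" "q \<noteq> p0" for a p q
  proof (rule alg_on_polyfun[where p = "?g a" and w = "\<lambda>v. component v p - component v q"])
    show "?g a \<in> polyfuns" using hom_g homog_polyfuns_subset by blast
    show "(\<lambda>v. (component v p - component v q) $ b) \<in> ?A" for b
      using alg_on_diff[OF coord[OF that(1)] coord[OF that(2)]] by simp
  qed
  \<comment> \<open>In the columns of \<open>q0\<close> only rows of pairs containing
    \<open>q0\<close> contribute, and \<open>e0\<close> is the only such pair that also contains
    \<open>p0\<close>. Hence the other entries do not involve the component
    \<open>p0\<close>.\<close>
  have entry: "(\<lambda>v. Jac (difference_map Q) v $ e $ (q0, a)) \<in> ?A" if "e \<noteq> e0" for e a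
  proof -
    obtain p q where e: "Rep_lt_pair e = (p, q)" by fastforce
    then have "p < q" using Rep_lt_pair[of e] by simp
    have "(p, q) \<noteq> (p0, q0)" using that e e0 Rep_lt_pair_inject by metis
    consider "p = q0" | "p \<noteq> q0" "q = q0" | "p \<noteq> q0" "q \<noteq> q0" by blast
    then show ?thesis
    proof cases
      case 1
      then have "p \<noteq> p0" "q \<noteq> p0" using \<open>p0 < q0\<close> \<open>p < q\<close> by auto
      from diff[OF this] show ?thesis by (rule alg_on_cong) (simp add: Jac_difference_map[OF e] 1)
    next
      case 2
      then have "p \<noteq> p0" "q \<noteq> p0" using \<open>p0 < q0\<close> \<open>(p, q) \<noteq> (p0, q0)\<close> by auto
      from alg_on_diff[OF alg_on_const[of 0] diff[OF this]] show ?thesis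
        by (rule alg_on_cong) (use 2 in \<open>simp add: Jac_difference_map[OF e]\<close>)
    next
      case 3
      from alg_on_const[of 0] show ?thesis
        by (rule alg_on_cong) (use 3 in \<open>simp add: Jac_difference_map[OF e]\<close>)
    qed
  qed
  have "growth_bounded (card I) X"
  proof (rule growth_bounded_integral[where s = "r - 1" and g = ?g and y = "\<lambda>v. component v p0 - component v q0" and u = u])
    show "r - 1 \<ge> 1" using \<open>r \<ge> 2\<close> by simp
    show "x = 0" if "\<And>a. ?g a x = 0" for x
      using ns that by (simp add: nonsingular_form_def vec_eq_iff)
    fix a
    \<comment> \<open>The relation in the column \<open>(q0, a)\<close> is solved for the entry of
      \<open>e0\<close>, whose coefficient is 1; that entry is minus the partial derivative.\<close>
    have "(\<Sum>e\<in>- {e0}. (\<lambda>v. c v e) * (\<lambda>v. Jac (difference_map Q) v $ e $ (q0, a))) \<in> ?A"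
      using coeff entry by (intro alg_on_sum alg_on_mult) auto
    then show "(\<lambda>v. ?g a (component v p0 - component v q0)) \<in> ?A"
    proof (rule alg_on_cong)
      fix v assume v: "v \<in> X"
      have J0: "Jac (difference_map Q) v $ e0 $ (q0, a) = - ?g a (component v p0 - component v q0)"
        using \<open>p0 < q0\<close> Jac_difference_map[OF e0, of Q v q0 a] by auto
      have "(\<Sum>e\<in>UNIV. c v e * Jac (difference_map Q) v $ e $ (q0, a))
          = c v e0 * Jac (difference_map Q) v $ e0 $ (q0, a) + (\<Sum>e\<in>- {e0}. c v e * Jac (difference_map Q) v $ e $ (q0, a))"
        by (simp add: sum.remove[of UNIV e0] Compl_eq_Diff_UNIV)
      then show "?g a (component v p0 - component v q0)
          = (\<Sum>e\<in>- {e0}. (\<lambda>v. c v e) * (\<lambda>v. Jac (difference_map Q) v $ e $ (q0, a))) v"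
        using c[OF v] J0 by (simp add: fun_apply add_eq_0_iff)
    qed
  next
    fix i :: "'m \<times> 'n"
    obtain k b where i: "i = (k, b)" by fastforce
    show "\<exists>f d b. f \<in> ?A \<and> (\<forall>v\<in>X. v $ i = f v + d * (component v p0 - component v q0) $ b)"
    \<comment> \<open>The component \<open>p0\<close>, absent from the generators, is recovered as
      the component \<open>q0\<close> plus the integral difference.\<close>
    proof (cases "k = p0")
      case True
      have "(\<lambda>v. component v q0 $ b) \<in> ?A" using \<open>p0 < q0\<close> by (intro coord) simp
      moreover have "v $ i = component v q0 $ b + 1 * (component v p0 - component v q0) $ b" for v :: "complex ^ ('m \<times> 'n)"
        by (simp add: i True component_def)
      ultimately show ?thesis
        by (intro exI[of _ "\<lambda>v. component v q0 $ b"] exI[of _ 1] exI[of _ b]) blast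
    next
      case False
      then have "(\<lambda>v. component v k $ b) \<in> ?A" by (rule coord)
      moreover have "v $ i = component v k $ b + 0 * (component v p0 - component v q0) $ b" for v :: "complex ^ ('m \<times> 'n)"
        by (simp add: i component_def)
      ultimately show ?thesis
        by (intro exI[of _ "\<lambda>v. component v k $ b"] exI[of _ 0] exI[of _ b]) blast
    qed
  qed (use hom_g in simp_all)
  moreover have "card I = (CARD('m) - 1) * CARD('n) + (CARD('m lt_pair) - 1)"
    by (simp add: I_def card_Plus card_cartesian_product Compl_eq_Diff_UNIV card_Diff_singleton)
  ultimately show ?thesis by (simp add: X_def)
qed

theorem proposition1p3:
  fixes Q :: "('n::finite, int) mpoly" and r :: nat
  assumes "even r" and "r \<ge> 4"
    and "homogeneous r Q"
    and "positive_definite_form Q"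
    and "convex_form Q"
    and "nonsingular_form Q"
  shows "birch_rank (difference_map Q :: complex ^ ('m::{card2,linorder} \<times> 'n) \<Rightarrow> complex ^ 'm lt_pair)
           \<ge> int CARD('n) - int (CARD('m) choose 2) + 1"
proof -
  let ?\<Phi> = "difference_map Q :: complex ^ ('m \<times> 'n) \<Rightarrow> complex ^ 'm lt_pair"
  have "growth_bounded ((CARD('m) - 1) * CARD('n) + (CARD('m lt_pair) - 1))
      (\<Union>e0 :: 'm lt_pair. relation_locus Q e0)"
    using assms by (intro growth_bounded_UN growth_bounded_relation_locus) auto
  then have "zariski_dim (birch_locus ?\<Phi>) \<le> (CARD('m) - 1) * CARD('n) + (CARD('m lt_pair) - 1)"
    using birch_locus_difference_map by (rule zariski_dim_le_growth)
  \<comment> \<open>With these bounds the subtractions of 1 in \<open>nat\<close> agree with those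
    in \<open>int\<close>.\<close>
  moreover have "CARD('m lt_pair) \<ge> 1" "CARD('m) \<ge> 1" by (simp_all add: Suc_le_eq)
  ultimately have "int (zariski_dim (birch_locus ?\<Phi>))
      \<le> (int CARD('m) - 1) * int CARD('n) + (int CARD('m lt_pair) - 1)"
    by (smt (verit, best) of_nat_1 of_nat_add of_nat_diff of_nat_mono of_nat_mult)
  then show ?thesis
    by (simp add: birch_rank_def card_lt_pair algebra_simps)
qed

end
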